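(* Let $n\ge 1$ be an integer. (1) Let $P\subseteq[0,1]^n$ be a compact convex set with $P_I\ne\emptyset$, let $c\in\mathbb{Z}^n\setminus\{0\}$, and let $N:=\lVert c\rVert_\infty$. Then $$\operatorname{depth}_P(c)\ \le\ 12.22\,n^2+2n+2\log_2 N+4.$$ (2) For every compact convex set $P\subseteq[0,1]^n$ (including those with $P_I=\emptyset$), $$\operatorname{rk}(P)\ \le\ 12.22\,n^2+n\log_2 n+2n+4.$$
   Context: For $a,x\in\mathbb{R}^n$, $ax:=\sum_{\ell=1}^n a_\ell x_\ell$ is the standard inner product. For a compact convex set $P\subseteq\mathbb{R}^n$, its Chvátal closure is $P':=\bigcap_{a\in\mathbb{Z}^n}\{x\in\mathbb{R}^n: ax\le\lfloor\max_{y\in P}ay\rfloor\}$ if $P\neq\emptyset$, and $P':=\emptyset$ if $P=\emptyset$. The integer hull is $P_I:=\operatorname{conv}(P\cap\mathbb{Z}^n)$. It is well known that $P_I\subseteq P'\subseteq P$, so $P'$ is again compact and convex. Define $P^{(0)}:=P$ and $P^{(k+1)}:=(P^{(k)})'$ for integers $k\ge 0$; $P^{(k)}$ is the $k$-th Chvátal closure. The Chvátal rank $\operatorname{rk}(P)$ is the least integer $k\ge0$ with $P^{(k)}=P_I$. If $P_I\ne\emptyset$, then for $v\in\mathbb{Z}^n$ let $h(v):=\max_{x\in P_I}vx$ (an integer), and let $\operatorname{depth}_P(v)$ be the least integer $k\ge 0$ such that $vx\le h(v)$ holds for all $x\in P^{(k)}$. An upper bound on $\operatorname{rk}(P)$ or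 $\operatorname{depth}_P(v)$ includes the assertion that such a $k$ exists. *)

theory Defs
  imports "HOL-Analysis.Analysis"
begin

definition integer_points :: "(real ^ 'n) set" where
  "integer_points = {x. \<forall>i. x $ i \<in> \<int>}"

definition integer_hull :: "(real ^ 'n) set \<Rightarrow> (real ^ 'n) set" where
  "integer_hull P = convex hull (P \<inter> integer_points)"

(* For compact nonempty P the supremum is attained, hence equals the maximum. *)
definition chvatal_closure :: "(real ^ 'n) set \<Rightarrow> (real ^ 'n) set" where
  "chvatal_closure P =
     (if P = {} then {}
      else \<Inter>a\<in>integer_points. {x. a \<bullet> x \<le> real_of_int \<lfloor>SUP y\<in>P. a \<bullet> y\<rfloor>})"

(* Rank and depth are extended naturals: the infimum of the empty set is \<infinity>,
   so a finite upper bound includes the existence of a suitable k. *)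
definition chvatal_rank :: "(real ^ 'n) set \<Rightarrow> enat" where
  "chvatal_rank P = Inf {enat k | k. (chvatal_closure ^^ k) P = integer_hull P}"

(* Only meaningful when the integer hull of P is nonempty. *)
definition chvatal_depth :: "(real ^ 'n) set \<Rightarrow> real ^ 'n \<Rightarrow> enat" where
  "chvatal_depth P v =
     Inf {enat k | k. \<forall>x\<in>(chvatal_closure ^^ k) P. v \<bullet> x \<le> (SUP y\<in>integer_hull P. v \<bullet> y)}"

lemma ereal_of_enat_Inf_le_iff:
  "ereal_of_enat (Inf {enat k | k. Q k}) \<le> ereal r \<longleftrightarrow> (\<exists>k. Q k \<and> real k \<le> r)"
proof
  assume le: "ereal_of_enat (Inf {enat k | k. Q k}) \<le> ereal r"
  have "{enat k | k. Q k} \<noteq> {}"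
  proof
    assume "{enat k | k. Q k} = {}"
    then have "Inf {enat k | k. Q k} = \<infinity>"
      unfolding Inf_enat_def by simp
    with le show False by simp
  qed
  then have "Inf {enat k | k. Q k} \<in> {enat k | k. Q k}"
    unfolding Inf_enat_def by (auto intro: LeastI)
  then obtain k where "Q k" "Inf {enat k | k. Q k} = enat k" by blast
  with le show "\<exists>k. Q k \<and> real k \<le> r" by auto
next
  assume "\<exists>k. Q k \<and> real k \<le> r"
  then obtain k where k: "Q k" "real k \<le> r" by blast
  then have "Inf {enat k | k. Q k} \<le> enat k" by (auto intro: Inf_lower)
  then have "ereal_of_enat (Inf {enat k | k. Q k}) \<le> ereal_of_enat (enat k)"
    by (simp only: ereal_of_enat_le_iff)
  also have "\<dots> \<le> ereal r" using k by simp
  finally show "ereal_of_enat (Inf {enat k | k. Q k}) \<le> ereal r" .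
qed

lemma chvatal_rank_le_iff:
  "ereal_of_enat (chvatal_rank P) \<le> ereal r \<longleftrightarrow>
     (\<exists>k. (chvatal_closure ^^ k) P = integer_hull P \<and> real k \<le> r)"
  unfolding chvatal_rank_def by (rule ereal_of_enat_Inf_le_iff)

lemma chvatal_depth_le_iff:
  "ereal_of_enat (chvatal_depth P v) \<le> ereal r \<longleftrightarrow>
     (\<exists>k. (\<forall>x\<in>(chvatal_closure ^^ k) P. v \<bullet> x \<le> (SUP y\<in>integer_hull P. v \<bullet> y)) \<and> real k \<le> r)"
  unfolding chvatal_depth_def by (rule ereal_of_enat_Inf_le_iff)

end

theory Submission
  imports Defs
begin

text \<open>
Let \<open>n\<close> be the dimension. The proof gives one bound for both parts: every compact
subset \<open>P\<close> of the unit cube reaches its integer hull after at most \<open>12.22 n\<^sup>2 + 2 n + 4\<close> closure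
steps, and the depth of any vector is at most the number of these steps.

Suppose an integer inequality \<open>z x \<le> \<beta>\<close> is valid for the integer points of \<open>P\<close>, and
\<open>z x \<le> \<beta> + m\<close> is known for the current closure. Then \<open>1 + 2 m\<close> further steps round it to
\<open>z x \<le> \<lfloor>\<beta>\<rfloor>\<close> (\<open>holds_from_gap\<close>), provided that on the
facets of each cube face the deduction is one step ahead.
Scheduling each face with a delay equal to its dimension, as \<open>holds_from\<close> does, makes this cost
an additive \<open>n\<close> for the whole argument.

Fix a rational direction \<open>\<alpha> = c / N\<close> of maximum norm at most 1 that is maximized over the integer
points at \<open>v0\<close>. An integer vector \<open>z\<close> close to \<open>d \<alpha>\<close> satisfies \<open>z (x - v0) \<le> B\<close> on the integer
points, where \<open>B\<close> is determined by the error \<open>z - d \<alpha>\<close>. These inequalities are established on the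
closures for all \<open>d \<le> 2\<^sup>j\<close> in turn. To pass from \<open>2\<^sup>j\<close> to \<open>2\<^sup>j\<^sup>+\<^sup>1\<close>, choose
\<open>q \<in> [2\<^sup>j\<^sup>-\<^sup>1, 2\<^sup>j]\<close> for which \<open>q \<alpha>\<close> is as close as possible to an integer vector, say within
\<open>\<epsilon>\<^sub>j\<close>, and subtract that vector from \<open>z\<close> at most twice. The gap is then at most \<open>2 n \<epsilon>\<^sub>j\<close>
(\<open>settled_step\<close>).

The errors \<open>\<epsilon>\<^sub>j\<close> have a sum of order \<open>n\<close>, up to rounding. If \<open>\<epsilon>\<^sub>j > \<epsilon>\<close>, then from an
\<open>\<epsilon>\<close>-separated set of multiples of \<open>\<alpha>\<close> in the torus with multipliers at most \<open>2\<^sup>j\<^sup>-\<^sup>2\<close> one obtains an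
\<open>\<epsilon>\<close>-separated set of twice the size with multipliers at most \<open>2\<^sup>j\<close>. By packing, this happens for at
most \<open>2 n log 2 (1 / \<epsilon>)\<close> levels \<open>j\<close> (\<open>stuck_count\<close>). Summing over \<open>\<epsilon> = m / (2 n)\<close> with
\<open>n\<^sup>n \<le> n! e\<^sup>n\<close> gives the quadratic bound, and about \<open>n log 2 (2 n)\<close> levels are used.

At that point Dirichlet's theorem supplies, for each such \<open>\<alpha>\<close>, a multiplier \<open>q\<close> and an integer
vector \<open>z\<close> within \<open>1 / (2 n)\<close> of \<open>q \<alpha>\<close>, and \<open>z (x - v0) \<le> 0\<close> holds on the closure. Now
\<open>\<alpha> - z / (2 q)\<close> is again maximized at \<open>v0\<close> over the integer points and has norm at most \<open>3 / 4\<close>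
(\<open>contract_direction\<close>). Iterating, \<open>\<alpha> (x - v0) \<le> (3 / 4)\<^sup>k n\<close> for all \<open>k\<close>, hence \<open>\<alpha> x \<le> \<alpha> v0\<close>.
A point outside the integer hull is separated from it by a rational direction, so the closure is the
integer hull.
\<close>

section \<open>Integral functionals and the Chvatal closure\<close>

text \<open>The linear functional with integer coefficients \<open>z\<close>; these are the cut vectors.\<close>

definition lin :: "('n::finite \<Rightarrow> int) \<Rightarrow> real ^ 'n \<Rightarrow> real" where
  "lin z x = (\<Sum>i\<in>UNIV. of_int (z i) * x $ i)"

lemma lin_add: "lin (\<lambda>i. a i + b i) x = lin a x + lin b x"
  by (simp add: lin_def algebra_simps sum.distrib)

lemma lin_diff: "lin (\<lambda>i. a i - b i) x = lin a x - lin b x"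
  by (simp add: lin_def algebra_simps sum_subtractf)

lemma lin_scale: "lin (\<lambda>i. k * a i) x = of_int k * lin a x"
  by (simp add: lin_def algebra_simps sum_distrib_left)

lemma lin_unit: "lin (\<lambda>j. if j = i then k else 0) x = of_int k * x $ i"
proof -
  have "lin (\<lambda>j. if j = i then k else 0) x = (\<Sum>j\<in>UNIV. if j = i then of_int k * x $ j else 0)"
    unfolding lin_def by (intro sum.cong) auto
  then show ?thesis by simp
qed

lemma lin_eq_inner: "lin z x = (\<chi> i. of_int (z i)) \<bullet> x"
  by (simp add: lin_def inner_vec_def)

lemma continuous_on_lin: "continuous_on S (lin z)"
  unfolding lin_eq_inner[abs_def] by (intro continuous_intros)

lemma lin_integral:
  assumes "x \<in> integer_points"
  shows "lin z x \<in> \<int>"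
  using assms unfolding lin_def integer_points_def by (auto intro!: Ints_sum Ints_mult)

text \<open>The only way in which cuts enter the argument: a strict bound by \<open>\<gamma> + 1\<close> on \<open>Q\<close>
improves to a bound by \<open>\<gamma>\<close> on the closure. Compactness is needed, because the supremum must
stay below \<open>\<gamma> + 1\<close>.\<close>

lemma chvatal_cut:
  assumes "compact Q" and lt: "\<And>y. y \<in> Q \<Longrightarrow> lin z y < of_int \<gamma> + 1" and x: "x \<in> chvatal_closure Q"
  shows "lin z x \<le> of_int \<gamma>"
proof -
  define a :: "real ^ 'a" where "a = (\<chi> i. of_int (z i))"
  have a: "a \<in> integer_points" by (simp add: a_def integer_points_def)
  have lin: "lin z y = a \<bullet> y" for y by (simp add: a_def lin_eq_inner)
  have ne: "Q \<noteq> {}" using x by (auto simp: chvatal_closure_def)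
  have "continuous_on Q (\<lambda>y. a \<bullet> y)" by (intro continuous_intros)
  then obtain y0 where y0: "y0 \<in> Q" "\<And>y. y \<in> Q \<Longrightarrow> a \<bullet> y \<le> a \<bullet> y0"
    using continuous_attains_sup[OF \<open>compact Q\<close> ne] by blast
  have "(SUP y\<in>Q. a \<bullet> y) \<le> a \<bullet> y0" using ne y0 by (intro cSUP_least) auto
  also have "\<dots> < of_int \<gamma> + 1" using lt[OF y0(1)] by (simp add: lin)
  finally have "\<lfloor>SUP y\<in>Q. a \<bullet> y\<rfloor> \<le> \<gamma>" by (simp add: floor_le_iff)
  moreover have "a \<bullet> x \<le> of_int \<lfloor>SUP y\<in>Q. a \<bullet> y\<rfloor>"
    using x a ne by (auto simp: chvatal_closure_def)
  ultimately show ?thesis unfolding lin by linarith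
qed

lemma closed_chvatal_closure: "closed (chvatal_closure Q)"
  unfolding chvatal_closure_def by (auto intro!: closed_INT closed_halfspace_le)

lemma convex_chvatal_closure: "convex (chvatal_closure Q)"
  unfolding chvatal_closure_def by (auto intro!: convex_INT convex_halfspace_le)

lemma integer_points_in_chvatal_closure:
  assumes "compact Q"
  shows "Q \<inter> integer_points \<subseteq> chvatal_closure Q"
proof
  fix p assume p: "p \<in> Q \<inter> integer_points"
  have "a \<bullet> p \<le> of_int \<lfloor>SUP y\<in>Q. a \<bullet> y\<rfloor>" if a: "a \<in> integer_points" for a
  proof -
    have "continuous_on Q (\<lambda>y. a \<bullet> y)" by (intro continuous_intros)
    then have "compact ((\<lambda>y. a \<bullet> y) ` Q)" using assms by (rule compact_continuous_image)
    then have "bdd_above ((\<lambda>y. a \<bullet> y) ` Q)" by (intro bounded_imp_bdd_above compact_imp_bounded)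
    then have le: "a \<bullet> p \<le> (SUP y\<in>Q. a \<bullet> y)" using p by (intro cSUP_upper) auto
    have "a \<bullet> p \<in> \<int>" using a p unfolding inner_vec_def integer_points_def
      by (auto intro!: Ints_sum Ints_mult)
    then obtain m where "a \<bullet> p = of_int m" by (auto elim: Ints_cases)
    with le show ?thesis by (simp add: le_floor_iff)
  qed
  then show "p \<in> chvatal_closure Q" using p by (auto simp: chvatal_closure_def)
qed

lemma chvatal_closure_subset_cube:
  fixes Q :: "(real ^ 'n) set"
  assumes "compact Q" "Q \<subseteq> cbox 0 1"
  shows "chvatal_closure Q \<subseteq> cbox 0 1"
proof
  fix x assume x: "x \<in> chvatal_closure Q"
  have cube: "0 \<le> y $ i" "y $ i \<le> 1" if "y \<in> Q" for y i
    using assms(2) that by (auto simp: mem_box_cart)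
  show "x \<in> cbox 0 1" unfolding mem_box_cart
  proof (intro allI conjI)
    fix i
    have "lin (\<lambda>j. if j = i then 1 else 0) x \<le> of_int 1"
    proof (rule chvatal_cut[OF assms(1) _ x])
      fix y assume "y \<in> Q"
      from cube(2)[OF this, of i] show "lin (\<lambda>j. if j = i then 1 else 0) y < of_int 1 + 1"
        by (simp add: lin_unit)
    qed
    then show "x $ i \<le> 1 $ i" by (simp add: lin_unit)
    have "lin (\<lambda>j. if j = i then -1 else 0) x \<le> of_int 0"
    proof (rule chvatal_cut[OF assms(1) _ x])
      fix y assume "y \<in> Q"
      from cube(1)[OF this, of i] show "lin (\<lambda>j. if j = i then -1 else 0) y < of_int 0 + 1"
        by (simp add: lin_unit)
    qed
    then show "0 $ i \<le> x $ i" by (simp add: lin_unit)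
  qed
qed

lemma iterate_compact_in_cube:
  assumes "compact P" "P \<subseteq> cbox 0 1"
  shows "compact ((chvatal_closure ^^ k) P) \<and> (chvatal_closure ^^ k) P \<subseteq> cbox 0 1"
proof (induction k)
  case (Suc k)
  let ?Q = "chvatal_closure ((chvatal_closure ^^ k) P)"
  have sub: "?Q \<subseteq> cbox 0 1" using chvatal_closure_subset_cube Suc by blast
  then have "bounded ?Q" using bounded_cbox bounded_subset by blast
  then have "compact ?Q" using closed_chvatal_closure by (simp add: compact_eq_bounded_closed)
  with sub show ?case by simp
qed (use assms in auto)

lemmas compact_iterate = iterate_compact_in_cube[THEN conjunct1]
lemmas iterate_subset_cube = iterate_compact_in_cube[THEN conjunct2]

lemma integer_points_in_iterate:
  assumes "compact P" "P \<subseteq> cbox 0 1"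
  shows "P \<inter> integer_points \<subseteq> (chvatal_closure ^^ k) P"
proof (induction k)
  case (Suc k)
  then show ?case
    using integer_points_in_chvatal_closure[OF compact_iterate[OF assms, of k]] by auto
qed simp

lemma integer_hull_subset_iterate:
  assumes "compact P" "P \<subseteq> cbox 0 1"
  shows "integer_hull P \<subseteq> (chvatal_closure ^^ Suc k) P"
  unfolding integer_hull_def
proof (rule hull_minimal)
  show "P \<inter> integer_points \<subseteq> (chvatal_closure ^^ Suc k) P"
    using integer_points_in_iterate[OF assms] .
  show "convex ((chvatal_closure ^^ Suc k) P)" by (simp add: convex_chvatal_closure)
qed

text \<open>A bound that holds on the face \<open>p = 0\<close> of a compact set extends to the whole set once a
sufficiently large multiple of \<open>p\<close> is added.\<close>

lemma penalty:
  fixes g p :: "'a::topological_space \<Rightarrow> real"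
  assumes K: "compact K" and g: "continuous_on UNIV g" and p: "continuous_on UNIV p"
    and neg: "\<And>y. y \<in> K \<Longrightarrow> p y \<le> 0"
    and lt: "\<And>y. y \<in> K \<Longrightarrow> p y = 0 \<Longrightarrow> g y < 1"
  shows "\<exists>M::nat. \<forall>y\<in>K. g y + real M * p y < 1"
proof (cases "K \<inter> {y. 1 \<le> g y} = {}")
  case True
  then have "\<forall>y\<in>K. g y + real 0 * p y < 1" by force
  then show ?thesis by blast
next
  case False
  define K1 where "K1 = K \<inter> {y. 1 \<le> g y}"
  have K1: "compact K1" unfolding K1_def
    by (intro compact_Int_closed K closed_Collect_le g continuous_intros)
  have ne: "K1 \<noteq> {}" using False by (simp add: K1_def)
  obtain y1 where y1: "y1 \<in> K1" "\<And>y. y \<in> K1 \<Longrightarrow> p y \<le> p y1"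
    using continuous_attains_sup[OF K1 ne continuous_on_subset[OF p]] by blast
  obtain y2 where y2: "y2 \<in> K1" "\<And>y. y \<in> K1 \<Longrightarrow> g y \<le> g y2"
    using continuous_attains_sup[OF K1 ne continuous_on_subset[OF g]] by blast
  have "p y1 < 0" using neg[of y1] lt[of y1] y1(1) unfolding K1_def by force
  \<comment> \<open>Where \<open>g\<close> is at least 1, \<open>p\<close> is bounded away from 0.\<close>
  then obtain M :: nat where M: "g y2 < real M * (- p y1)"
    using reals_Archimedean3[of "- p y1"] by auto
  have "g y + real M * p y < 1" if y: "y \<in> K" for y
  proof (cases "y \<in> K1")
    case True
    have "real M * p y \<le> real M * p y1" using y1(2)[OF True] by (intro mult_left_mono) auto
    then show ?thesis using M y2(2)[OF True] by simp
  next
    case False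
    have "real M * p y \<le> 0" using neg[OF y] by (simp add: mult_nonneg_nonpos)
    then show ?thesis using False y by (simp add: K1_def)
  qed
  then show ?thesis by blast
qed

section \<open>Faces of the cube\<close>

text \<open>The face of the unit cube in which the coordinates in \<open>S\<close> are fixed to the bits \<open>w\<close>;
it has dimension \<open>CARD('n) - card S\<close>.\<close>

definition face :: "'n set \<Rightarrow> ('n \<Rightarrow> bool) \<Rightarrow> (real ^ 'n) set" where
  "face S w = {x \<in> cbox 0 1. \<forall>i\<in>S. x $ i = of_bool (w i)}"

text \<open>The face is where the functional \<open>face_normal S w\<close> attains its maximum
\<open>face_offset S w\<close> over the cube.\<close>

definition face_normal :: "'n set \<Rightarrow> ('n \<Rightarrow> bool) \<Rightarrow> 'n \<Rightarrow> int" where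
  "face_normal S w i = (if i \<in> S then (if w i then 1 else -1) else 0)"

definition face_offset :: "'n set \<Rightarrow> ('n::finite \<Rightarrow> bool) \<Rightarrow> int" where
  "face_offset S w = int (card {i\<in>S. w i})"

lemma face_normal_lin:
  "lin (face_normal S w) x - of_int (face_offset S w) = (\<Sum>i\<in>S. if w i then x $ i - 1 else - x $ i)"
proof -
  have "lin (face_normal S w) x = (\<Sum>i\<in>S. if w i then x $ i else - x $ i)"
    unfolding lin_def by (rule sum.mono_neutral_cong_right) (auto simp: face_normal_def)
  moreover have "real_of_int (face_offset S w) = (\<Sum>i\<in>S. if w i then 1 else 0)"
    unfolding face_offset_def by (simp add: sum.If_cases Int_def)
  ultimately show ?thesis by (auto simp: sum_subtractf[symmetric] intro!: sum.cong)
qed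

lemma face_normal_le:
  assumes "x \<in> cbox 0 1"
  shows "lin (face_normal S w) x - of_int (face_offset S w) \<le> 0"
  unfolding face_normal_lin using assms by (intro sum_nonpos) (auto simp: mem_box_cart)

lemma face_normal_eq_iff:
  assumes "x \<in> cbox 0 1"
  shows "lin (face_normal S w) x - of_int (face_offset S w) = 0 \<longleftrightarrow> x \<in> face S w"
proof -
  have "(\<Sum>i\<in>S. - (if w i then x $ i - 1 else - x $ i)) = 0 \<longleftrightarrow>
    (\<forall>i\<in>S. - (if w i then x $ i - 1 else - x $ i) = 0)"
    using assms by (intro sum_nonneg_eq_0_iff) (auto simp: mem_box_cart)
  then have "(\<Sum>i\<in>S. if w i then x $ i - 1 else - x $ i) = 0 \<longleftrightarrow>
    (\<forall>i\<in>S. (if w i then x $ i - 1 else - x $ i) = 0)"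
    by (simp only: sum_negf neg_equal_0_iff_equal)
  then show ?thesis unfolding face_normal_lin face_def using assms by auto
qed

lemma closed_face: "closed (face S w)"
proof -
  have "face S w = cbox 0 1 \<inter> (\<Inter>i\<in>S. {x. x $ i = of_bool (w i)})" by (auto simp: face_def)
  then show ?thesis by (auto intro!: closed_Int closed_INT closed_Collect_eq continuous_intros closed_cbox)
qed

text \<open>Rounding works on each face separately: a cut that is valid on a face becomes valid on all
of \<open>Q\<close> after adding a large multiple of the face normal.\<close>

lemma face_cut:
  assumes Q: "compact Q" "Q \<subseteq> cbox 0 1"
    and lt: "\<And>y. y \<in> Q \<Longrightarrow> y \<in> face S w \<Longrightarrow> lin z y < of_int \<gamma> + 1"
    and x: "x \<in> chvatal_closure Q" "x \<in> face S w"
  shows "lin z x \<le> of_int \<gamma>"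
proof -
  let ?p = "\<lambda>y. lin (face_normal S w) y - of_int (face_offset S w)"
  have "\<exists>M::nat. \<forall>y\<in>Q. (lin z y - of_int \<gamma>) + real M * ?p y < 1"
  proof (intro penalty Q(1) continuous_intros continuous_on_lin)
    fix y assume y: "y \<in> Q"
    then have cube: "y \<in> cbox 0 1" using Q(2) by blast
    show "?p y \<le> 0" using face_normal_le[OF cube] .
    assume "?p y = 0"
    then have "y \<in> face S w" using face_normal_eq_iff[OF cube] by blast
    from lt[OF y this] show "lin z y - of_int \<gamma> < 1" by simp
  qed
  then obtain M :: nat where M: "\<And>y. y \<in> Q \<Longrightarrow> (lin z y - of_int \<gamma>) + real M * ?p y < 1" by blast
  have "lin (\<lambda>i. z i + int M * face_normal S w i) x \<le> of_int (\<gamma> + int M * face_offset S w)"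
    by (rule chvatal_cut[OF Q(1) _ x(1)])
      (use M in \<open>auto simp: lin_add lin_scale algebra_simps\<close>)
  moreover have "?p x = 0" using x(2) face_normal_eq_iff[of x S w] by (auto simp: face_def)
  ultimately show ?thesis by (simp add: lin_add lin_scale)
qed

text \<open>If the hyperplane \<open>z x = \<gamma>\<close> supports the part of \<open>Q\<close> in a face, and avoids the facet \<open>x\<^sub>i = 1\<close>
of that face on \<open>Q\<close> and the facet \<open>x\<^sub>i = 0\<close> on the closure, then one closure step
makes the inequality strict. The cut vector is the unit vector
\<open>e\<^sub>i\<close> plus a large multiple of \<open>z\<close>: on the hyperplane it gives \<open>x\<^sub>i < 1\<close>, and rounding forces
\<open>x\<^sub>i = 0\<close> there.\<close>

lemma face_strict_cut:
  assumes Q: "compact Q" "Q \<subseteq> cbox 0 1"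
    and le: "\<And>y. y \<in> Q \<Longrightarrow> y \<in> face S w \<Longrightarrow> lin z y \<le> of_int \<gamma>"
    and i: "i \<notin> S"
    and facet: "\<And>y. y \<in> Q \<Longrightarrow> y \<in> face (insert i S) (w(i := True)) \<Longrightarrow> lin z y < of_int \<gamma>"
    and facet': "\<And>y. y \<in> chvatal_closure Q \<Longrightarrow> y \<in> face (insert i S) (w(i := False)) \<Longrightarrow> lin z y < of_int \<gamma>"
    and x: "x \<in> chvatal_closure Q" "x \<in> face S w"
  shows "lin z x < of_int \<gamma>"
proof -
  have x_le: "lin z x \<le> of_int \<gamma>" by (rule face_cut[OF Q _ x]) (use le in \<open>fastforce intro: le_less_trans\<close>)
  have "\<exists>M::nat. \<forall>y\<in>Q \<inter> face S w. y $ i + real M * (lin z y - of_int \<gamma>) < 1"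
  proof (intro penalty compact_Int_closed Q(1) closed_face continuous_intros continuous_on_lin)
    fix y assume y: "y \<in> Q \<inter> face S w"
    then show "lin z y - of_int \<gamma> \<le> 0" using le by simp
    assume eq: "lin z y - of_int \<gamma> = 0"
    have "y $ i \<noteq> 1"
    proof
      assume "y $ i = 1"
      then have "y \<in> face (insert i S) (w(i := True))" using y i by (auto simp: face_def)
      with facet[of y] y eq show False by auto
    qed
    moreover have "y $ i \<le> 1" using y by (auto simp: face_def mem_box_cart)
    ultimately show "y $ i < 1" by simp
  qed
  then obtain M :: nat where M: "\<And>y. y \<in> Q \<Longrightarrow> y \<in> face S w \<Longrightarrow> y $ i + real M * (lin z y - of_int \<gamma>) < 1"
    by blast
  have "lin (\<lambda>j. (if j = i then 1 else 0) + int M * z j) x \<le> of_int (int M * \<gamma>)"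
    by (rule face_cut[OF Q _ x]) (use M in \<open>auto simp: lin_add lin_scale lin_unit algebra_simps\<close>)
  then have *: "x $ i + real M * (lin z x - of_int \<gamma>) \<le> 0"
    by (simp add: lin_add lin_scale lin_unit algebra_simps)
  show ?thesis
  proof (rule ccontr)
    assume "\<not> ?thesis"
    with x_le have eq: "lin z x = of_int \<gamma>" by simp
    have "x $ i \<ge> 0" using x(2) by (auto simp: face_def mem_box_cart)
    with * eq have "x $ i = 0" by simp
    then have "x \<in> face (insert i S) (w(i := False))" using x(2) i by (auto simp: face_def)
    with facet'[of x] x(1) eq show False by auto
  qed
qed

lemma vertex_of_iterate:
  assumes P: "compact P" "P \<subseteq> cbox 0 1"
    and x: "x \<in> (chvatal_closure ^^ k) P" "x \<in> face UNIV w"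
  shows "x \<in> P \<inter> integer_points"
proof -
  have uniq: "y = x" if "y \<in> face UNIV w" for y
    using that x(2) by (auto simp: face_def vec_eq_iff)
  have "x \<in> P" using x(1)
  proof (induction k)
    case (Suc k)
    let ?Q = "(chvatal_closure ^^ k) P"
    show ?case
    proof (rule ccontr)
      assume "x \<notin> P"
      then have "x \<notin> ?Q" using Suc by blast
      then have "\<And>y. y \<in> ?Q \<Longrightarrow> y \<in> face UNIV w \<Longrightarrow> False" using uniq by blast
      then have "lin (\<lambda>_. 0) x \<le> of_int (-1)"
        using Suc(2) by (intro face_cut[OF compact_iterate[OF P] iterate_subset_cube[OF P] _ _ x(2)]) auto
      then show False by (simp add: lin_def)
    qed
  qed simp
  moreover have "x \<in> integer_points" using x(2) by (auto simp: face_def integer_points_def)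
  ultimately show ?thesis by blast
qed

text \<open>\<open>holds_from P t A\<close>: the part of the \<open>k\<close>-th closure in a \<open>d\<close>-dimensional face of the cube lies
in \<open>A\<close> for all \<open>k \<ge> d + t\<close>. Delaying each face by its dimension lets the facets run one step ahead
of a face, so that a sequence of \<open>t\<close> deductions costs \<open>CARD('n) + t\<close> closure steps in total, rather
than \<open>CARD('n)\<close> for each deduction.\<close>

definition holds_from :: "(real ^ 'n) set \<Rightarrow> nat \<Rightarrow> (real ^ 'n) set \<Rightarrow> bool" where
  "holds_from P t A \<longleftrightarrow>
     (\<forall>S w k. CARD('n) - card S + t \<le> k \<longrightarrow> (chvatal_closure ^^ k) P \<inter> face S w \<subseteq> A)"

lemma holds_from_mono:
  assumes "holds_from P t A" "t \<le> t'" "A \<inter> cbox 0 1 \<subseteq> B"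
  shows "holds_from P t' B"
  unfolding holds_from_def
proof (intro allI impI)
  fix S :: "'a set" and w k assume "CARD('a) - card S + t' \<le> k"
  then have "(chvatal_closure ^^ k) P \<inter> face S w \<subseteq> A"
    using assms(1)[unfolded holds_from_def, rule_format, of S k w] assms(2) by linarith
  moreover have "face S w \<subseteq> cbox 0 1" by (auto simp: face_def)
  ultimately show "(chvatal_closure ^^ k) P \<inter> face S w \<subseteq> B" using assms(3) by blast
qed

lemma holds_from_Int:
  assumes "holds_from P t A" "holds_from P t B"
  shows "holds_from P t (A \<inter> B)"
  using assms unfolding holds_from_def by blast

lemma holds_from_cube: "holds_from P t (cbox 0 1)"
  unfolding holds_from_def face_def by auto

lemma holds_fromD:
  assumes "holds_from P t A" "P \<subseteq> cbox 0 1" "compact P" "CARD('n) + t \<le> k"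
  shows "(chvatal_closure ^^ k) (P :: (real ^ 'n) set) \<subseteq> A"
proof -
  have "(chvatal_closure ^^ k) P \<inter> face {} undefined \<subseteq> A"
    using assms(1,4) unfolding holds_from_def by auto
  moreover have "face {} undefined = (cbox 0 1 :: (real ^ 'n) set)" by (auto simp: face_def)
  ultimately show ?thesis using iterate_subset_cube[OF assms(3,2), of k] by blast
qed

lemma holds_from_round:
  assumes P: "compact P" "P \<subseteq> cbox 0 1"
    and "holds_from P t {x. lin z x < of_int \<gamma> + 1}"
  shows "holds_from P (Suc t) {x. lin z x \<le> of_int \<gamma>}"
  unfolding holds_from_def
proof (intro allI impI)
  fix S :: "'a set" and w k assume k: "CARD('a) - card S + Suc t \<le> k"
  then obtain k' where k': "k = Suc k'" by (cases k) auto
  let ?Q = "(chvatal_closure ^^ k') P"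
  have "?Q \<inter> face S w \<subseteq> {x. lin z x < of_int \<gamma> + 1}"
    using assms(3) k k' unfolding holds_from_def by auto
  then show "(chvatal_closure ^^ k) P \<inter> face S w \<subseteq> {x. lin z x \<le> of_int \<gamma>}"
    using face_cut[OF compact_iterate[OF P, of k'] iterate_subset_cube[OF P, of k'], of S w z \<gamma>] k' by auto
qed

text \<open>Induction on the dimension of the face. On a vertex only integer points of \<open>P\<close> survive; a larger
face is handled by \<open>face_strict_cut\<close>, because its facets satisfy the strict inequality already.\<close>

lemma holds_from_strict:
  assumes P: "compact P" "P \<subseteq> cbox 0 1"
    and le: "holds_from P t {x. lin z x \<le> of_int \<gamma>}"
    and V: "\<And>v. v \<in> P \<inter> integer_points \<Longrightarrow> lin z v < of_int \<gamma>"
  shows "holds_from P (Suc t) {x. lin z x < of_int \<gamma>}"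
proof -
  have "(chvatal_closure ^^ k) P \<inter> face S w \<subseteq> {x. lin z x < of_int \<gamma>}"
    if "CARD('a) - card S = d" "d + Suc t \<le> k" for d S w k
    using that
  proof (induction d arbitrary: S w k)
    case 0
    then have "card S = CARD('a)" using card_mono[of UNIV S] by simp
    then have "S = UNIV" by (simp add: card_eq_UNIV_imp_eq_UNIV)
    then show ?case using vertex_of_iterate[OF P] V by blast
  next
    case (Suc d)
    then have "S \<noteq> UNIV" by auto
    then obtain i where i: "i \<notin> S" by blast
    obtain k' where k': "k = Suc k'" using Suc.prems by (cases k) auto
    have d: "CARD('a) - card (insert i S) = d" using Suc.prems(1) i by simp
    let ?Q = "(chvatal_closure ^^ k') P"
    have "?Q \<inter> face S w \<subseteq> {x. lin z x \<le> of_int \<gamma>}"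
      using le Suc.prems k' unfolding holds_from_def by auto
    note le_Q = this
    have "?Q \<inter> face (insert i S) (w(i := True)) \<subseteq> {x. lin z x < of_int \<gamma>}"
      using Suc.IH[OF d, of k'] Suc.prems(2) k' by simp
    note facet = this
    have "chvatal_closure ?Q \<inter> face (insert i S) (w(i := False)) \<subseteq> {x. lin z x < of_int \<gamma>}"
      using Suc.IH[OF d, of k] Suc.prems(2) k' by simp
    note facet' = this
    show ?case
    proof
      fix x assume "x \<in> (chvatal_closure ^^ k) P \<inter> face S w"
      then have x: "x \<in> chvatal_closure ?Q" "x \<in> face S w" using k' by auto
      have "lin z x < of_int \<gamma>"
      proof (rule face_strict_cut[OF compact_iterate[OF P] iterate_subset_cube[OF P] _ i _ _ x])
        show "lin z y \<le> of_int \<gamma>" if "y \<in> ?Q" "y \<in> face S w" for y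
          using subsetD[OF le_Q IntI[OF that]] by simp
        show "lin z y < of_int \<gamma>" if "y \<in> ?Q" "y \<in> face (insert i S) (w(i := True))" for y
          using subsetD[OF facet IntI[OF that]] by simp
        show "lin z y < of_int \<gamma>"
          if "y \<in> chvatal_closure ?Q" "y \<in> face (insert i S) (w(i := False))" for y
          using subsetD[OF facet' IntI[OF that]] by simp
      qed
      then show "x \<in> {x. lin z x < of_int \<gamma>}" by simp
    qed
  qed
  then show ?thesis unfolding holds_from_def by blast
qed

lemma holds_from_descend:
  assumes P: "compact P" "P \<subseteq> cbox 0 1"
    and V: "\<And>v. v \<in> P \<inter> integer_points \<Longrightarrow> lin z v \<le> of_int \<gamma>"
    and "holds_from P t {x. lin z x \<le> of_int (\<gamma> + int m)}"
  shows "holds_from P (t + 2 * m) {x. lin z x \<le> of_int \<gamma>}"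
  using assms(4)
proof (induction m arbitrary: t)
  case (Suc m)
  have "holds_from P (Suc t) {x. lin z x < of_int (\<gamma> + int (Suc m))}"
    by (rule holds_from_strict[OF P Suc.prems]) (use V in \<open>fastforce intro: le_less_trans\<close>)
  then have "holds_from P (Suc t) {x. lin z x < of_int (\<gamma> + int m) + 1}"
    by (simp add: algebra_simps)
  then have "holds_from P (Suc (Suc t)) {x. lin z x \<le> of_int (\<gamma> + int m)}"
    by (rule holds_from_round[OF P])
  from Suc.IH[OF this] show ?case by simp
qed simp

text \<open>A gap of \<open>m\<close> above a bound \<open>\<beta>\<close> that is valid for the integer points is closed in \<open>1 + 2 m\<close>
steps: one rounding, then per unit one step to a strict inequality and one rounding.\<close>

lemma holds_from_gap:
  assumes P: "compact P" "P \<subseteq> cbox 0 1" and v0: "v0 \<in> integer_points"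
    and V: "\<And>v. v \<in> P \<inter> integer_points \<Longrightarrow> lin z v - lin z v0 \<le> \<beta>"
    and "holds_from P t {x. lin z x - lin z v0 \<le> \<beta> + real m}"
  shows "holds_from P (t + (1 + 2 * m)) {x. lin z x - lin z v0 \<le> of_int \<lfloor>\<beta>\<rfloor>}"
proof -
  obtain \<delta> where \<delta>: "lin z v0 = of_int \<delta>" using lin_integral[OF v0] by (auto elim: Ints_cases)
  define \<gamma> where "\<gamma> = \<delta> + \<lfloor>\<beta>\<rfloor>"
  have Vf: "lin z v \<le> of_int \<gamma>" if v: "v \<in> P \<inter> integer_points" for v
  proof -
    obtain \<eta> where \<eta>: "lin z v = of_int \<eta>" using lin_integral[of v z] v by (auto elim: Ints_cases)
    have "\<eta> - \<delta> \<le> \<lfloor>\<beta>\<rfloor>" using V[OF v] \<delta> \<eta> by (simp add: le_floor_iff)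
    then have "\<eta> \<le> \<gamma>" by (simp add: \<gamma>_def)
    then show ?thesis using \<eta> by simp
  qed
  have "holds_from P t {x. lin z x < of_int (\<gamma> + int m) + 1}"
    by (rule holds_from_mono[OF assms(5)]) (auto simp: \<gamma>_def \<delta>, linarith)
  from holds_from_descend[OF P Vf holds_from_round[OF P this]]
  have "holds_from P (Suc t + 2 * m) {x. lin z x \<le> of_int \<gamma>}" by blast
  then show ?thesis by (auto simp: \<gamma>_def \<delta> algebra_simps)
qed

section \<open>Simultaneous approximation of a rational direction\<close>

text \<open>With \<open>n = CARD('n)\<close>: each coordinate of the multiple \<open>q c / N\<close> is within \<open>m / (2 n)\<close> of an
integer. Denominators are cleared.\<close>

definition near_int :: "('n::finite \<Rightarrow> int) \<Rightarrow> nat \<Rightarrow> nat \<Rightarrow> nat \<Rightarrow> bool" where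
  "near_int c N m q \<longleftrightarrow>
     (\<exists>z :: 'n \<Rightarrow> int. \<forall>i. 2 * int CARD('n) * \<bar>int q * c i - int N * z i\<bar> \<le> int (m * N))"

lemma near_int_trivial: "N \<ge> 1 \<Longrightarrow> near_int (c :: 'n::finite \<Rightarrow> int) N (CARD('n)) q"
  unfolding near_int_def
proof (intro exI allI)
  fix i assume N: "N \<ge> 1"
  let ?a = "int q * c i"
  let ?z = "round (of_int ?a / of_nat N :: real)"
  have "\<bar>of_int ?z - of_int ?a / of_nat N :: real\<bar> \<le> 1/2" by (rule of_int_round_abs_le)
  then have "real N * \<bar>of_int ?z - of_int ?a / of_nat N :: real\<bar> \<le> real N * (1/2)"
    by (intro mult_left_mono) auto
  also have "real N * \<bar>of_int ?z - of_int ?a / of_nat N :: real\<bar> = \<bar>real N * (of_int ?z - of_int ?a / of_nat N)\<bar>"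
    by (simp add: abs_mult)
  also have "real N * (of_int ?z - of_int ?a / of_nat N) = of_int (int N * ?z - ?a)"
    using N by (simp add: field_simps)
  finally have "real_of_int (2 * \<bar>?a - int N * ?z\<bar>) \<le> real_of_int (int N)" by (simp add: abs_minus_commute)
  then have "2 * \<bar>?a - int N * ?z\<bar> \<le> int N" by linarith
  then have "int CARD('n) * (2 * \<bar>?a - int N * ?z\<bar>) \<le> int CARD('n) * int N"
    by (intro mult_left_mono) auto
  then show "2 * int CARD('n) * \<bar>?a - int N * ?z\<bar> \<le> int (CARD('n) * N)" by (simp add: algebra_simps)
qed

text \<open>The multiples \<open>a c / N\<close> for \<open>a \<in> A\<close> are pairwise more than \<open>m / (2 n)\<close> apart in the maximum
metric of the torus.\<close>

definition separated :: "('n::finite \<Rightarrow> int) \<Rightarrow> nat \<Rightarrow> nat \<Rightarrow> nat set \<Rightarrow> bool" where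
  "separated c N m A \<longleftrightarrow> (\<forall>a\<in>A. \<forall>b\<in>A. a < b \<longrightarrow> \<not> near_int c N m (b - a))"

text \<open>Packing bound. The multiples lie in the group of residues modulo \<open>N\<close> in each coordinate, and boxes
of side \<open>L > m N / (2 n)\<close> attached to separated points are disjoint, so there are at most
\<open>(N / L)\<^sup>n\<close> of them.\<close>

lemma separated_card_le:
  fixes c :: "'n::finite \<Rightarrow> int"
  assumes N: "N \<ge> 1" and m: "m < 2 * CARD('n)" and fin: "finite A" and sep: "separated c N m A"
  shows "card A * m ^ CARD('n) \<le> (2 * CARD('n)) ^ CARD('n)"
proof -
  define n where "n = CARD('n)"
  have n: "n > 0" by (simp add: n_def)
  define L where "L = m * N div (2 * n) + 1"
  have L_le: "L \<le> N"
  proof -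
    have "m * N div (2 * n) < N" using m N n by (simp add: div_less_iff_less_mult n_def)
    then show ?thesis by (simp add: L_def)
  qed
  have L_close: "2 * int n * \<bar>y - y'\<bar> \<le> int (m * N)"
    if "0 \<le> y" "y < int L" "0 \<le> y'" "y' < int L" for y y' :: int
  proof -
    have "\<bar>y - y'\<bar> \<le> int (m * N div (2 * n))" using that by (simp add: L_def)
    then have "2 * int n * \<bar>y - y'\<bar> \<le> 2 * int n * int (m * N div (2 * n))" by (intro mult_left_mono) auto
    also have "\<dots> = int (2 * n * (m * N div (2 * n)))" by simp
    also have "\<dots> \<le> int (m * N)" unfolding of_nat_le_iff by (rule times_div_less_eq_dividend)
    finally show ?thesis .
  qed
  define Y where "Y = (UNIV :: 'n set) \<rightarrow>\<^sub>E {0..<int L}"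
  define G where "G = (UNIV :: 'n set) \<rightarrow>\<^sub>E {0..<int N}"
  define \<phi> where "\<phi> = (\<lambda>(a, y) i. (int a * c i + y i) mod int N)"
  \<comment> \<open>Overlapping boxes around \<open>a < b\<close> would make \<open>b - a\<close> a good multiplier.\<close>
  have no: False
    if "a \<in> A" "b \<in> A" "a < b" "y \<in> Y" "y' \<in> Y" "\<phi> (a, y) = \<phi> (b, y')" for a b y y'
  proof -
    have "\<exists>z. (int b - int a) * c i - int N * z = y i - y' i" for i
    proof -
      have "(int a * c i + y i) mod int N = (int b * c i + y' i) mod int N"
        using fun_cong[OF that(6), of i] by (simp add: \<phi>_def)
      then have "int N dvd (int b * c i + y' i) - (int a * c i + y i)"
        by (metis mod_eq_dvd_iff)
      then obtain z where "(int b * c i + y' i) - (int a * c i + y i) = int N * z" by (elim dvdE)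
      then have "(int b - int a) * c i - int N * z = y i - y' i" by (simp add: algebra_simps)
      then show ?thesis ..
    qed
    then obtain z where z: "\<And>i. (int b - int a) * c i - int N * z i = y i - y' i" by metis
    have "2 * int n * \<bar>int (b - a) * c i - int N * z i\<bar> \<le> int (m * N)" for i
    proof -
      have yi: "y i \<in> {0..<int L}" "y' i \<in> {0..<int L}" using that(4,5) by (auto simp: Y_def)
      have "int (b - a) * c i - int N * z i = y i - y' i" using z[of i] that(3) by (simp add: of_nat_diff)
      then show ?thesis using L_close[of "y i" "y' i"] yi by simp
    qed
    then have "near_int c N m (b - a)" unfolding near_int_def n_def by blast
    with sep that(1-3) show False unfolding separated_def by blast
  qed
  have inj: "inj_on \<phi> (A \<times> Y)"
  proof (rule inj_onI)
    fix p p' assume p: "p \<in> A \<times> Y" "p' \<in> A \<times> Y" and eq: "\<phi> p = \<phi> p'"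
    obtain a y b y' where pp: "p = (a, y)" "p' = (b, y')" by (cases p, cases p')
    have ab: "a = b"
      using no[of a b y y'] no[of b a y' y] p eq unfolding pp by (cases a b rule: linorder_cases) auto
    have "y i = y' i" for i
    proof -
      have yi: "y i \<in> {0..<int N}" "y' i \<in> {0..<int N}"
        using p L_le unfolding pp Y_def by (auto simp: PiE_iff dest!: spec[of _ i])
      have "(int a * c i + y i) mod int N = (int a * c i + y' i) mod int N"
        using fun_cong[OF eq, of i] by (simp add: pp \<phi>_def ab)
      then have "int N dvd (int a * c i + y i) - (int a * c i + y' i)" by (metis mod_eq_dvd_iff)
      then have "int N dvd y i - y' i" by (simp add: algebra_simps)
      then have "y i mod int N = y' i mod int N" by (metis mod_eq_dvd_iff)
      then show ?thesis using yi by simp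
    qed
    then show "p = p'" using ab pp by auto
  qed
  have "\<phi> ` (A \<times> Y) \<subseteq> G" using N by (auto simp: \<phi>_def G_def)
  moreover have "finite G" unfolding G_def by (intro finite_PiE) auto
  ultimately have "card (A \<times> Y) \<le> card G" using card_inj_on_le[OF inj] by blast
  then have le: "card A * L ^ n \<le> N ^ n"
    by (simp add: card_cartesian_product Y_def G_def card_PiE n_def)
  have "m * N \<le> 2 * n * L"
  proof -
    have "m * N = 2 * n * (m * N div (2 * n)) + m * N mod (2 * n)" by simp
    moreover have "m * N mod (2 * n) < 2 * n" using n by simp
    ultimately show ?thesis unfolding L_def by (simp only: distrib_left)
  qed
  then have "(m * N) ^ n \<le> (2 * n * L) ^ n" by (rule power_mono) simp
  then have "card A * m ^ n * N ^ n \<le> card A * L ^ n * (2 * n) ^ n"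
    by (simp add: power_mult_distrib algebra_simps)
  also have "\<dots> \<le> (2 * n) ^ n * N ^ n" using le by simp
  finally have "card A * m ^ n * N ^ n \<le> (2 * n) ^ n * N ^ n" .
  then show ?thesis using N by (simp add: n_def)
qed

text \<open>No multiplier in the dyadic window \<open>[2\<^sup>j\<^sup>-\<^sup>1, 2\<^sup>j]\<close> brings the direction within \<open>m / (2 n)\<close> of
an integer vector. The window is stated as \<open>2\<^sup>j \<le> 2 q\<close> so that \<open>j = 0\<close> gives \<open>q = 1\<close>.\<close>

definition stuck :: "('n::finite \<Rightarrow> int) \<Rightarrow> nat \<Rightarrow> nat \<Rightarrow> nat \<Rightarrow> bool" where
  "stuck c N m j \<longleftrightarrow> (\<forall>q. 2 ^ j \<le> 2 * q \<and> q \<le> 2 ^ j \<longrightarrow> \<not> near_int c N m q)"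

lemma separated_translate: "separated c N m A \<Longrightarrow> separated c N m ((\<lambda>a. a + t) ` A)"
  unfolding separated_def by auto

lemma separated_double:
  assumes sep: "separated c N m A" "A \<subseteq> {0..r}" and stuck: "stuck c N m j"
    and t: "t + r \<le> 2 ^ j" "2 ^ j + 2 * r \<le> 2 * t"
  shows "separated c N m (A \<union> (\<lambda>a. a + t) ` A)"
  unfolding separated_def
proof (intro ballI impI)
  fix a b assume ab: "a \<in> A \<union> (\<lambda>a. a + t) ` A" "b \<in> A \<union> (\<lambda>a. a + t) ` A" "a < b"
  have rt: "r < t"
  proof -
    have "0 < (2::nat) ^ j" by simp
    then show ?thesis using t(2) by linarith
  qed
  consider "a \<in> A" "b \<in> A" | "a \<in> (\<lambda>a. a + t) ` A" "b \<in> (\<lambda>a. a + t) ` A"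
    | b' where "a \<in> A" "b' \<in> A" "b = b' + t" | a' where "a' \<in> A" "b \<in> A" "a = a' + t"
    using ab by blast
  then show "\<not> near_int c N m (b - a)"
  proof cases
    case 1 then show ?thesis using sep(1) ab(3) unfolding separated_def by blast
  next
    case 2 then show ?thesis
      using separated_translate[OF sep(1), of t] ab(3) unfolding separated_def by blast
  next
    case 3
    then have "a \<le> r" "b' \<le> r" using sep(2) by auto
    then have "2 ^ j \<le> 2 * (b - a)" "b - a \<le> 2 ^ j" using 3 t by linarith+
    then show ?thesis using stuck unfolding stuck_def by blast
  next
    case 4
    then have "b \<le> r" using sep(2) by auto
    then show ?thesis using 4 ab(3) rt by linarith
  qed
qed

text \<open>At a stuck level \<open>j\<close> a separated set in \<open>[0, 2\<^sup>j\<^sup>-\<^sup>2]\<close> can be doubled: its translate by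
\<open>3 \<cdot> 2\<^sup>j\<^sup>-\<^sup>2\<close> stays in \<open>[0, 2\<^sup>j]\<close>, and all differences between the two copies fall into the
window. The recursion skips a level, whence the parity condition; at the levels 0 and 1 the set
\<open>{0, 2\<^sup>j}\<close> serves.\<close>

lemma separated_exists:
  "\<exists>A. A \<subseteq> {0..2 ^ j} \<and> separated c N m A \<and>
       card A = 2 ^ card {i. i \<le> j \<and> even (i + j) \<and> stuck c N m i}"
proof (induction j rule: less_induct)
  case (less j)
  let ?S = "\<lambda>j. {i. i \<le> j \<and> even (i + j) \<and> stuck c N m i}"
  have fin: "finite (?S i)" for i by simp
  show ?case
  proof (cases "j < 2")
    case True
    show ?thesis
    proof (cases "stuck c N m j")
      case True
      have "?S j = {j}" using \<open>j < 2\<close> True by (auto simp: less_2_cases_iff le_Suc_eq)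
      moreover have "separated c N m {0, 2 ^ j}" using True
        unfolding separated_def stuck_def by auto
      ultimately show ?thesis by (intro exI[of _ "{0, 2 ^ j}"]) auto
    next
      case False
      have "?S j = {}" using \<open>j < 2\<close> False by (auto simp: less_2_cases_iff le_Suc_eq)
      then have "card {0::nat} = 2 ^ card (?S j)" by (simp only: card.empty) simp
      then show ?thesis by (intro exI[of _ "{0}"]) (auto simp: separated_def)
    qed
  next
    case False
    then obtain j' where j': "j = Suc (Suc j')" by (metis add_2_eq_Suc le_add_diff_inverse not_less)
    obtain A where A: "A \<subseteq> {0..2 ^ j'}" "separated c N m A" "card A = 2 ^ card (?S j')"
      using less[of j'] j' by auto
    show ?thesis
    proof (cases "stuck c N m j")
      case True
      let ?t = "3 * 2 ^ j'"
      let ?B = "A \<union> (\<lambda>a. a + ?t) ` A"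
      have "separated c N m ?B"
        by (rule separated_double[OF A(2,1) True]) (simp_all add: j')
      moreover have "?B \<subseteq> {0..2 ^ j}" using A(1) by (force simp: j')
      moreover have "card ?B = 2 ^ card (?S j)"
      proof -
        have "finite A" using A(1) finite_subset by blast
        moreover have "x \<noteq> y + ?t" if "x \<in> A" "y \<in> A" for x y
        proof -
          have "x \<le> 2 ^ j'" using A(1) that by auto
          moreover have "0 < (2::nat) ^ j'" by simp
          ultimately show ?thesis by linarith
        qed
        then have "A \<inter> (\<lambda>a. a + ?t) ` A = {}" by blast
        ultimately have "card ?B = 2 * card A" by (simp add: card_Un_disjoint card_image)
        moreover have "?S j = insert j (?S j')"
          using True by (auto simp: j' le_Suc_eq)
        then have "card (?S j) = Suc (card (?S j'))" using fin[of j'] by (simp add: j')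
        ultimately show ?thesis using A(3) by simp
      qed
      ultimately show ?thesis by blast
    next
      case False
      have "?S j = ?S j'" using False by (auto simp: j' le_Suc_eq)
      moreover have "A \<subseteq> {0..2 ^ j}" using A(1) by (force simp: j')
      ultimately show ?thesis using A by auto
    qed
  qed
qed

lemma stuck_count_parity:
  fixes c :: "'n::finite \<Rightarrow> int"
  assumes N: "N \<ge> 1" and m: "m < 2 * CARD('n)" "m \<ge> 1"
  shows "real (card {i. i \<le> j \<and> even (i + j) \<and> stuck c N m i})
           \<le> real CARD('n) * log 2 (2 * real CARD('n) / real m)"
proof -
  define n where "n = CARD('n)"
  let ?k = "card {i. i \<le> j \<and> even (i + j) \<and> stuck c N m i}"
  obtain A where A: "A \<subseteq> {0..2 ^ j}" "separated c N m A" "card A = 2 ^ ?k"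
    using separated_exists by blast
  have "2 ^ ?k * m ^ n \<le> (2 * n) ^ n"
    using separated_card_le[OF N m(1) _ A(2)] A(1,3) finite_subset[OF A(1)] unfolding n_def by simp
  then have "real (2 ^ ?k * m ^ n) \<le> real ((2 * n) ^ n)" by (rule of_nat_mono)
  then have "2 ^ ?k \<le> (2 * real n / real m) ^ n"
    using m by (simp add: power_divide field_simps)
  then have "log 2 (2 ^ ?k) \<le> log 2 ((2 * real n / real m) ^ n)"
    by (intro log_mono) auto
  also have "\<dots> = real n * log 2 (2 * real n / real m)"
    using m by (intro log_nat_power) (simp add: n_def)
  finally show ?thesis by (simp add: n_def log_nat_power)
qed

lemma stuck_count:
  fixes c :: "'n::finite \<Rightarrow> int"
  assumes N: "N \<ge> 1" and m: "m < 2 * CARD('n)" "m \<ge> 1"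
  shows "real (card {j. j < J \<and> stuck c N m j})
           \<le> 2 * real CARD('n) * log 2 (2 * real CARD('n) / real m)"
proof -
  let ?S = "\<lambda>j. {i. i \<le> j \<and> even (i + j) \<and> stuck c N m i}"
  have "{j. j < J \<and> stuck c N m j} \<subseteq> ?S J \<union> ?S (Suc J)" by auto
  then have "card {j. j < J \<and> stuck c N m j} \<le> card (?S J \<union> ?S (Suc J))"
    by (intro card_mono) auto
  also have "\<dots> \<le> card (?S J) + card (?S (Suc J))" by (rule card_Un_le)
  finally show ?thesis
    using stuck_count_parity[OF N m, of J c] stuck_count_parity[OF N m, of "Suc J" c] by linarith
qed

text \<open>Dirichlet's theorem on simultaneous approximation.\<close>

lemma exists_near_int:
  fixes c :: "'n::finite \<Rightarrow> int"
  assumes N: "N \<ge> 1" and Q: "(2 * CARD('n)) ^ CARD('n) \<le> Q"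
  shows "\<exists>q. 1 \<le> q \<and> q \<le> Q \<and> near_int c N 1 q"
proof (rule ccontr)
  assume *: "\<not> ?thesis"
  have "separated c N 1 {0..Q}" unfolding separated_def
  proof (intro ballI impI)
    fix a b assume "a \<in> {0..Q}" "b \<in> {0..Q}" "a < b"
    then have "1 \<le> b - a" "b - a \<le> Q" by auto
    with * show "\<not> near_int c N 1 (b - a)" by blast
  qed
  moreover have "1 < 2 * CARD('n)" using zero_less_card_finite[where 'a='n] by linarith
  ultimately have "card {0..Q} * 1 ^ CARD('n) \<le> (2 * CARD('n)) ^ CARD('n)"
    using N by (intro separated_card_le) auto
  with Q show False by simp
qed

text \<open>The best approximation quality, in units of \<open>1 / (2 n)\<close>, that a multiplier in the window of
level \<open>j\<close> achieves.\<close>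

definition approx_error :: "('n::finite \<Rightarrow> int) \<Rightarrow> nat \<Rightarrow> nat \<Rightarrow> nat" where
  "approx_error c N j = (LEAST m. \<exists>q. 2 ^ j \<le> 2 * q \<and> q \<le> 2 ^ j \<and> near_int c N m q)"

lemma approx_error_witness:
  assumes "N \<ge> 1"
  shows "\<exists>q. 2 ^ j \<le> 2 * q \<and> q \<le> 2 ^ j \<and> near_int c N (approx_error c N j) q"
  unfolding approx_error_def
proof (rule LeastI)
  have "near_int c N CARD('a) (2 ^ j)" by (rule near_int_trivial[OF assms])
  then show "\<exists>q. 2 ^ j \<le> 2 * q \<and> q \<le> 2 ^ j \<and> near_int c N CARD('a) q"
    by (intro exI[of _ "2 ^ j"]) auto
qed

lemma approx_error_le: 
  fixes c :: "'n::finite \<Rightarrow> int"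
  assumes "N \<ge> 1"
  shows "approx_error c N j \<le> CARD('n)"
  unfolding approx_error_def
proof (rule Least_le)
  have "near_int c N CARD('n) (2 ^ j)" by (rule near_int_trivial[OF assms])
  then show "\<exists>q. 2 ^ j \<le> 2 * q \<and> q \<le> 2 ^ j \<and> near_int c N CARD('n) q"
    by (intro exI[of _ "2 ^ j"]) auto
qed

lemma stuck_if_less_approx_error: "m < approx_error c N j \<Longrightarrow> stuck c N m j"
  unfolding approx_error_def stuck_def using not_less_Least by blast

text \<open>One term of the exponential series.\<close>

lemma power_self_le_fact_mult_exp: "real n ^ n \<le> fact n * exp (real n)"
proof -
  have "(\<Sum>k\<in>{n}. inverse (fact k) * real n ^ k) \<le> (\<Sum>k. inverse (fact k) * real n ^ k)"
    by (intro sum_le_suminf summable_exp) auto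
  also have "\<dots> = exp (real n)" by (simp add: exp_def)
  finally show ?thesis by (simp add: field_simps)
qed

lemma sum_log_le:
  assumes n: "n \<ge> 1"
  shows "(\<Sum>m=1..<n. log 2 (2 * real n / real m)) \<le> real n * (1 + 1 / ln 2) - 1"
proof -
  have "ln (real n ^ n) \<le> ln (fact n * exp (real n))"
    using power_self_le_fact_mult_exp[of n] n by (intro ln_mono) auto
  then have stirling: "real n * ln (real n) \<le> ln (fact n) + real n"
    using n by (simp add: ln_realpow ln_mult_pos)
  have fact: "(\<Sum>m=1..k. ln (real m)) = ln (fact k)" for k
    by (induction k) (simp_all add: ln_mult_pos)
  have "(\<Sum>m=1..<n. ln (2 * real n / real m)) + ln 2 = (\<Sum>m=1..n. ln (2 * real n / real m))"
    using n by (simp add: atLeastLessThanSuc_atLeastAtMost[symmetric] del: atLeastLessThanSuc)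
  also have "\<dots> = (\<Sum>m=1..n. ln (2 * real n) - ln (real m))"
    using n by (intro sum.cong) (auto simp: ln_div)
  also have "\<dots> = real n * ln (2 * real n) - ln (fact n)"
    by (simp only: sum_subtractf fact) simp
  also have "\<dots> \<le> real n * ln 2 + real n"
    using stirling n by (simp add: ln_mult_pos algebra_simps)
  finally have "(\<Sum>m=1..<n. ln (2 * real n / real m)) \<le> real n * (ln 2 + 1) - ln 2"
    by (simp add: algebra_simps)
  then have "(\<Sum>m=1..<n. ln (2 * real n / real m)) / ln 2 \<le> (real n * (ln 2 + 1) - ln 2) / ln 2"
    by (intro divide_right_mono) auto
  also have "\<dots> = real n * (1 + 1 / ln 2) - 1" by (simp add: field_simps)
  finally show ?thesis by (simp add: log_def sum_divide_distrib)
qed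

text \<open>The total approximation error is linear in the number of levels plus a term quadratic in the
dimension, since \<open>approx_error c N j > m\<close> makes level \<open>j\<close> stuck for \<open>m\<close>, and few levels are stuck.\<close>

lemma sum_approx_error_le:
  fixes c :: "'n::finite \<Rightarrow> int"
  assumes N: "N \<ge> 1"
  shows "real (\<Sum>j<J. approx_error c N j) \<le> real J + 2 * real CARD('n) * (real CARD('n) * (1 + 1 / ln 2) - 1)"
proof -
  define n where "n = CARD('n)"
  have n: "n \<ge> 1" by (simp add: n_def Suc_le_eq)
  have "approx_error c N j = (\<Sum>m<n. if m < approx_error c N j then 1 else 0)" for j
  proof -
    have "{..<n} \<inter> {m. m < approx_error c N j} = {..<approx_error c N j}" using approx_error_le[OF N, of c j] by (auto simp: n_def)
    then show ?thesis by (simp add: sum.If_cases)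
  qed
  then have "(\<Sum>j<J. approx_error c N j) = (\<Sum>j<J. \<Sum>m<n. if m < approx_error c N j then 1 else 0)" by (intro sum.cong) auto
  also have "\<dots> = (\<Sum>m<n. \<Sum>j<J. if m < approx_error c N j then 1 else 0)" by (rule sum.swap)
  also have "\<dots> = (\<Sum>m<n. card {j. j < J \<and> m < approx_error c N j})"
    by (intro sum.cong) (auto simp: sum.If_cases Int_def)
  also have "\<dots> = card {j. j < J \<and> 0 < approx_error c N j} + (\<Sum>m=1..<n. card {j. j < J \<and> m < approx_error c N j})"
    using n by (simp add: lessThan_atLeast0 sum.atLeast_Suc_lessThan)
  finally have eq: "real (\<Sum>j<J. approx_error c N j) = real (card {j. j < J \<and> 0 < approx_error c N j})
      + (\<Sum>m=1..<n. real (card {j. j < J \<and> m < approx_error c N j}))" by simp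
  have "card {j. j < J \<and> 0 < approx_error c N j} \<le> card {..<J}" by (intro card_mono) auto
  then have J: "real (card {j. j < J \<and> 0 < approx_error c N j}) \<le> real J" by simp
  have "(\<Sum>m=1..<n. real (card {j. j < J \<and> m < approx_error c N j})) \<le>
        (\<Sum>m=1..<n. 2 * real n * log 2 (2 * real n / real m))"
  proof (rule sum_mono)
    fix m assume m: "m \<in> {1..<n}"
    have "card {j. j < J \<and> m < approx_error c N j} \<le> card {j. j < J \<and> stuck c N m j}"
      using stuck_if_less_approx_error by (intro card_mono) auto
    then show "real (card {j. j < J \<and> m < approx_error c N j}) \<le> 2 * real n * log 2 (2 * real n / real m)"
      using stuck_count[OF N, of m J c] m unfolding n_def by fastforce
  qed
  also have "\<dots> = 2 * real n * (\<Sum>m=1..<n. log 2 (2 * real n / real m))" by (simp add: sum_distrib_left)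
  also have "\<dots> \<le> 2 * real n * (real n * (1 + 1 / ln 2) - 1)"
    using sum_log_le[OF n] by (intro mult_left_mono) auto
  finally show ?thesis using eq J by (simp add: n_def)
qed

section \<open>Bounds along multiples of a normal direction\<close>

text \<open>For a vertex \<open>v\<close> of the unit cube this is the maximum of \<open>\<Sum>\<^sub>i e\<^sub>i (x\<^sub>i - v\<^sub>i)\<close> over the cube.\<close>

definition cube_sup :: "real ^ 'n \<Rightarrow> ('n::finite \<Rightarrow> real) \<Rightarrow> real" where
  "cube_sup v e = (\<Sum>i\<in>UNIV. max 0 (if v $ i = 0 then e i else - e i))"

lemma cube_sup_add: "cube_sup v (\<lambda>i. e i + f i) \<le> cube_sup v e + cube_sup v f"
  unfolding cube_sup_def sum.distrib[symmetric] by (intro sum_mono) auto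

lemma cube_sup_minus: "cube_sup v e + cube_sup v (\<lambda>i. - e i) \<le> (\<Sum>i\<in>UNIV. \<bar>e i\<bar>)"
  unfolding cube_sup_def sum.distrib[symmetric] by (intro sum_mono) auto

lemma cube_sup_le_abs: "cube_sup v e \<le> (\<Sum>i\<in>UNIV. \<bar>e i\<bar>)"
  unfolding cube_sup_def by (intro sum_mono) auto

lemma cube_sup_upper:
  assumes x: "x \<in> cbox 0 1" and v: "v \<in> cbox 0 1" "v \<in> integer_points"
  shows "(\<Sum>i\<in>UNIV. e i * (x $ i - v $ i)) \<le> cube_sup v e"
  unfolding cube_sup_def
proof (rule sum_mono)
  fix i
  have x': "0 \<le> x $ i" "x $ i \<le> 1" using x by (auto simp: mem_box_cart)
  have v': "0 \<le> v $ i" "v $ i \<le> 1" "v $ i \<in> \<int>" using v by (auto simp: mem_box_cart integer_points_def)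
  then obtain k where k: "v $ i = of_int k" by (auto elim: Ints_cases)
  with v' have "k = 0 \<or> k = 1" by auto
  then consider "v $ i = 0" | "v $ i = 1" using k by auto
  then show "e i * (x $ i - v $ i) \<le> max 0 (if v $ i = 0 then e i else - e i)"
  proof cases
    case 1
    have "e i * x $ i \<le> max 0 (e i) * 1" using x' by (intro mult_mono) auto
    then show ?thesis using 1 by simp
  next
    case 2
    have "- e i * (1 - x $ i) \<le> max 0 (- e i) * 1" using x' by (intro mult_mono) auto
    then show ?thesis using 2 by (simp add: algebra_simps)
  qed
qed

lemma lin_diff_points: "lin z x - lin z v = (\<Sum>i\<in>UNIV. of_int (z i) * (x $ i - v $ i))"
  by (simp add: lin_def sum_subtractf algebra_simps)

text \<open>A rational direction \<open>c / N\<close> in the unit ball of the maximum norm that is maximized over the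
integer points of \<open>P\<close> by \<open>v0\<close>.\<close>

locale normal_direction =
  fixes P :: "(real ^ 'n) set" and v0 :: "real ^ 'n" and c :: "'n \<Rightarrow> int" and N :: nat
  assumes compact: "compact P" and cube: "P \<subseteq> cbox 0 1"
    and v0: "v0 \<in> P \<inter> integer_points"
    and N: "N \<ge> 1" and c_le: "\<bar>c i\<bar> \<le> int N"
    and opt: "v \<in> P \<inter> integer_points \<Longrightarrow> lin c v \<le> lin c v0"
begin

text \<open>A bound, in terms of the error \<open>z - d c / N\<close> alone, on how far an integer functional \<open>z\<close> can
exceed its value at \<open>v0\<close> on the integer points of \<open>P\<close>.\<close>

definition budget :: "nat \<Rightarrow> ('n \<Rightarrow> int) \<Rightarrow> real" where
  "budget d z = cube_sup v0 (\<lambda>i. of_int (z i) - real d * of_int (c i) / real N)"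

text \<open>After delay \<open>t\<close>, every integer functional respects its budget for every multiple up to \<open>s\<close>.
No bound on the distance between \<open>z\<close> and \<open>d c / N\<close> is imposed; this makes the class closed under
subtracting approximations.\<close>

definition settled :: "nat \<Rightarrow> nat \<Rightarrow> bool" where
  "settled s t \<longleftrightarrow>
     (\<forall>d\<le>s. \<forall>z. holds_from P t {x. lin z x - lin z v0 \<le> of_int \<lfloor>budget d z\<rfloor>})"

lemma lin_le_budget:
  assumes x: "x \<in> cbox 0 1"
  shows "lin z x - lin z v0 \<le> budget d z + real d / real N * (lin c x - lin c v0)"
proof -
  have "lin z x - lin z v0 =
      (\<Sum>i\<in>UNIV. (of_int (z i) - real d * of_int (c i) / real N) * (x $ i - v0 $ i))
      + real d / real N * (lin c x - lin c v0)"
    unfolding lin_diff_points sum_distrib_left sum.distrib[symmetric]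
    by (intro sum.cong) (use N in \<open>auto simp: field_simps\<close>)
  moreover have "(\<Sum>i\<in>UNIV. (of_int (z i) - real d * of_int (c i) / real N) * (x $ i - v0 $ i)) \<le> budget d z"
    unfolding budget_def by (rule cube_sup_upper[OF x]) (use v0 cube in auto)
  ultimately show ?thesis by linarith
qed

lemma lin_le_budget_integer:
  assumes v: "v \<in> P \<inter> integer_points"
  shows "lin z v - lin z v0 \<le> budget d z"
proof -
  have "real d / real N * (lin c v - lin c v0) \<le> 0" using opt[OF v]
    by (intro mult_nonneg_nonpos) auto
  moreover have "v \<in> cbox 0 1" using v cube by blast
  ultimately show ?thesis using lin_le_budget[of v z d] by linarith
qed

lemma lin_c_le:
  assumes x: "x \<in> cbox 0 1"
  shows "lin c x - lin c v0 \<le> real CARD('n) * real N"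
proof -
  have "lin c x - lin c v0 \<le> (\<Sum>i\<in>(UNIV::'n set). real N)"
    unfolding lin_diff_points
  proof (rule sum_mono)
    fix i
    have "v0 \<in> cbox 0 1" using v0 cube by blast
    then have "0 \<le> x $ i" "x $ i \<le> 1" "0 \<le> v0 $ i" "v0 $ i \<le> 1"
      using x by (auto simp: mem_box_cart)
    then have "\<bar>x $ i - v0 $ i\<bar> \<le> 1" by linarith
    moreover have "\<bar>real_of_int (c i)\<bar> \<le> real N" using c_le[of i] by linarith
    ultimately have "\<bar>real_of_int (c i)\<bar> * \<bar>x $ i - v0 $ i\<bar> \<le> real N * 1" by (intro mult_mono) auto
    then show "of_int (c i) * (x $ i - v0 $ i) \<le> real N" by (simp add: abs_mult[symmetric])
  qed
  then show ?thesis by simp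
qed

lemma settled_base: "settled 1 (1 + 2 * CARD('n))"
  unfolding settled_def
proof (intro allI impI)
  fix d :: nat and z assume d: "d \<le> 1"
  have "holds_from P 0 {x. lin z x - lin z v0 \<le> budget d z + real CARD('n)}"
  proof (rule holds_from_mono[OF holds_from_cube])
    show "cbox 0 1 \<inter> cbox 0 1 \<subseteq> {x. lin z x - lin z v0 \<le> budget d z + real CARD('n)}"
    proof safe
      fix x :: "real ^ 'n" assume x: "x \<in> cbox 0 1"
      have "real d / real N * (lin c x - lin c v0) \<le> real d / real N * (real CARD('n) * real N)"
        by (intro mult_left_mono lin_c_le x) auto
      also have "\<dots> = real d * real CARD('n)" using N by simp
      also have "\<dots> \<le> 1 * real CARD('n)" using d by (intro mult_right_mono) auto
      finally show "lin z x - lin z v0 \<le> budget d z + real CARD('n)"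
        using lin_le_budget[OF x, of z d] by linarith
    qed
  qed simp
  from holds_from_gap[OF compact cube _ lin_le_budget_integer this] v0
  show "holds_from P (1 + 2 * CARD('n)) {x. lin z x - lin z v0 \<le> of_int \<lfloor>budget d z\<rfloor>}" by simp
qed

text \<open>Doubling the range of multiples. Subtracting a good approximation \<open>y\<close> of \<open>q c / N\<close> at most twice
brings \<open>d \<le> 2 s\<close> down to the settled range, and each subtraction adds at most
\<open>m / 2\<close> to the budget.\<close>

lemma settled_step:
  assumes set: "settled s t" and q: "s \<le> 2 * q" "q \<le> s" and near: "near_int c N m q"
  shows "settled (2 * s) (t + (1 + 2 * m))"
  unfolding settled_def
proof (intro allI impI)
  fix d :: nat and z assume d: "d \<le> 2 * s"
  obtain y where y: "\<And>i. 2 * int CARD('n) * \<bar>int q * c i - int N * y i\<bar> \<le> int (m * N)"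
    using near unfolding near_int_def by blast
  define e where "e = (\<lambda>i. of_int (y i) - real q * of_int (c i) / real N)"
  have "\<bar>e i\<bar> \<le> real m / (2 * real CARD('n))" for i
  proof -
    have "e i = - of_int (int q * c i - int N * y i) / real N"
      using N by (simp add: e_def field_simps)
    then have "\<bar>e i\<bar> = of_int \<bar>int q * c i - int N * y i\<bar> / real N"
      by (simp only: abs_divide abs_minus_cancel of_int_abs abs_of_nat)
    moreover have "real_of_int (2 * int CARD('n) * \<bar>int q * c i - int N * y i\<bar>) \<le> real_of_int (int (m * N))"
      using y[of i] of_int_le_iff by blast
    then have "real_of_int \<bar>int q * c i - int N * y i\<bar> / real N \<le> real m / (2 * real CARD('n))"
      using N by (simp only: of_int_mult of_int_of_nat_eq of_nat_mult of_int_numeral) (simp add: field_simps)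
    ultimately show ?thesis by simp
  qed
  then have "(\<Sum>i\<in>UNIV. \<bar>e i\<bar>) \<le> (\<Sum>i\<in>(UNIV::'n set). real m / (2 * real CARD('n)))"
    by (intro sum_mono)
  then have e: "(\<Sum>i\<in>UNIV. \<bar>e i\<bar>) \<le> real m / 2" by simp
  have budget_y: "budget q y = cube_sup v0 e" by (simp add: budget_def e_def)
  have reduce: "budget (d - q) (\<lambda>i. z i - y i) + budget q y \<le> budget d z + real m / 2"
    if "q \<le> d" for d z
  proof -
    have "budget (d - q) (\<lambda>i. z i - y i)
        = cube_sup v0 (\<lambda>i. (of_int (z i) - real d * of_int (c i) / real N) + - e i)"
      unfolding budget_def e_def
      by (rule arg_cong[where f = "cube_sup v0"], rule ext)
        (use that N in \<open>simp add: of_nat_diff field_simps\<close>)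
    also have "\<dots> \<le> budget d z + cube_sup v0 (\<lambda>i. - e i)"
      unfolding budget_def by (rule cube_sup_add)
    finally show ?thesis using cube_sup_minus[of v0 e] e budget_y by linarith
  qed
  have y_holds: "holds_from P t {x. lin y x - lin y v0 \<le> of_int \<lfloor>budget q y\<rfloor>}"
    using set q unfolding settled_def by blast
  have "holds_from P t {x. lin z x - lin z v0 \<le> budget d z + real m}"
  proof (cases "d \<le> s")
    case True
    then have "holds_from P t {x. lin z x - lin z v0 \<le> of_int \<lfloor>budget d z\<rfloor>}"
      using set unfolding settled_def by blast
    then show ?thesis
    proof (rule holds_from_mono)
      show "{x. lin z x - lin z v0 \<le> of_int \<lfloor>budget d z\<rfloor>} \<inter> cbox 0 1
          \<subseteq> {x. lin z x - lin z v0 \<le> budget d z + real m}"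
        using of_int_floor_le[of "budget d z"] by (safe, linarith)
    qed simp
  next
    case False
    show ?thesis
    proof (cases "d - q \<le> s")
      case True
      have "holds_from P t {x. lin (\<lambda>i. z i - y i) x - lin (\<lambda>i. z i - y i) v0
              \<le> of_int \<lfloor>budget (d - q) (\<lambda>i. z i - y i)\<rfloor>}"
        using set True unfolding settled_def by blast
      from holds_from_Int[OF this y_holds] show ?thesis
      proof (rule holds_from_mono, goal_cases)
        case 2
        have "q \<le> d" using False q by simp
        from reduce[OF this, of z] show ?case
          using of_int_floor_le[of "budget (d - q) (\<lambda>i. z i - y i)"] of_int_floor_le[of "budget q y"]
          unfolding lin_diff by (safe, linarith)
      qed simp
    next
      case far: False
      have dq: "q \<le> d" "q \<le> d - q" "d - q - q \<le> s" using False far d q by linarith+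
      let ?w = "\<lambda>i. z i - y i - y i"
      have "holds_from P t {x. lin ?w x - lin ?w v0 \<le> of_int \<lfloor>budget (d - q - q) ?w\<rfloor>}"
        using set dq unfolding settled_def by blast
      from holds_from_Int[OF this y_holds] show ?thesis
      proof (rule holds_from_mono, goal_cases)
        case 2
        show ?case
          using of_int_floor_le[of "budget (d - q - q) ?w"] of_int_floor_le[of "budget q y"]
            reduce[OF dq(1), of z] reduce[OF dq(2), of "\<lambda>i. z i - y i"]
          unfolding lin_diff by (safe, linarith)
      qed simp
    qed
  qed
  from holds_from_gap[OF compact cube _ lin_le_budget_integer this] v0
  show "holds_from P (t + (1 + 2 * m)) {x. lin z x - lin z v0 \<le> of_int \<lfloor>budget d z\<rfloor>}" by simp
qed

lemma settled_power:
  "settled (2 ^ J) (1 + 2 * CARD('n) + (\<Sum>j<J. 1 + 2 * approx_error c N j))"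
proof (induction J)
  case 0
  then show ?case using settled_base by simp
next
  case (Suc J)
  obtain q where "2 ^ J \<le> 2 * q" "q \<le> 2 ^ J" "near_int c N (approx_error c N J) q"
    using approx_error_witness[OF N] by blast
  from settled_step[OF Suc this] show ?case by (simp add: algebra_simps)
qed

text \<open>By now some multiple \<open>q c / N\<close> is within \<open>1 / (2 n)\<close> of an integer vector \<open>z\<close>. Its budget is
at most \<open>1 / 2\<close>, and since bounds are rounded down, \<open>z\<close> is at most its value at \<open>v0\<close> on the closure.\<close>

lemma good_approximation:
  assumes J: "(2 * CARD('n)) ^ CARD('n) \<le> 2 ^ J"
    and k: "CARD('n) + (1 + 2 * CARD('n) + (\<Sum>j<J. 1 + 2 * approx_error c N j)) \<le> k"
    and x: "x \<in> (chvatal_closure ^^ k) P"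
  shows "\<exists>q\<ge>1. \<exists>z. lin z x \<le> lin z v0 \<and>
    (\<forall>i. 2 * int CARD('n) * \<bar>int q * c i - int N * z i\<bar> \<le> int N)"
proof -
  obtain q where q: "1 \<le> q" "q \<le> 2 ^ J" "near_int c N 1 q" using exists_near_int[OF N J] by blast
  then obtain z where z: "\<And>i. 2 * int CARD('n) * \<bar>int q * c i - int N * z i\<bar> \<le> int N"
    unfolding near_int_def by auto
  have "budget q z \<le> (\<Sum>i\<in>UNIV. \<bar>of_int (z i) - real q * of_int (c i) / real N\<bar>)"
    unfolding budget_def by (rule cube_sup_le_abs)
  also have "\<dots> \<le> (\<Sum>i\<in>(UNIV::'n set). 1 / (2 * real CARD('n)))"
  proof (rule sum_mono)
    fix i
    have "of_int (z i) - real q * of_int (c i) / real N = - of_int (int q * c i - int N * z i) / real N"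
      using N by (simp add: field_simps)
    then have "\<bar>of_int (z i) - real q * of_int (c i) / real N\<bar> = of_int \<bar>int q * c i - int N * z i\<bar> / real N"
      by (simp only: abs_divide abs_minus_cancel of_int_abs abs_of_nat)
    moreover have "real_of_int (2 * int CARD('n) * \<bar>int q * c i - int N * z i\<bar>) \<le> real_of_int (int N)"
      using z[of i] of_int_le_iff by blast
    ultimately show "\<bar>of_int (z i) - real q * of_int (c i) / real N\<bar> \<le> 1 / (2 * real CARD('n))"
      using N by (simp add: field_simps)
  qed
  also have "\<dots> = 1 / 2" by simp
  finally have "\<lfloor>budget q z\<rfloor> \<le> 0" by linarith
  moreover have "(chvatal_closure ^^ k) P \<subseteq> {x. lin z x - lin z v0 \<le> of_int \<lfloor>budget q z\<rfloor>}"
    using settled_power[of J] q(2) unfolding settled_def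
    by (intro holds_fromD[OF _ cube compact k]) blast
  ultimately have "lin z x - lin z v0 \<le> of_int \<lfloor>budget q z\<rfloor>" "real_of_int \<lfloor>budget q z\<rfloor> \<le> 0"
    using x by auto
  then have "lin z x \<le> lin z v0" by linarith
  then show ?thesis using q(1) z by blast
qed

end

section \<open>From bounded multiples to all directions\<close>

lemma lin_contracted:
  "lin (\<lambda>i. 8 * int q * c i - 4 * int N * z i) x = 8 * real q * lin c x - 4 * real N * lin z x"
  unfolding lin_diff lin_scale[of "8 * int q" c] lin_scale[of "4 * int N" z] by simp

text \<open>If \<open>z\<close> is within \<open>1 / (2 n)\<close> of \<open>q c / N\<close>, then \<open>c / N - z / (2 q)\<close> is again maximal at \<open>v0\<close>
over the integer points and has norm at most \<open>3 / 4\<close>; here it is rescaled by \<open>4 / 3\<close>.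
For an integer point \<open>v\<close>, the integer \<open>a = z (v - v0)\<close> differs from \<open>q c (v - v0) / N \<le> 0\<close> by at
most \<open>1 / 2\<close>. So \<open>a \<le> 0\<close>, and if \<open>a \<le> -1\<close> then \<open>q c (v - v0) / N \<le> a + 1 / 2 \<le> a / 2\<close>.\<close>

lemma contract_direction:
  assumes dir: "normal_direction (P :: (real ^ 'n) set) v0 c N" and q: "q \<ge> 1"
    and z: "\<And>i. 2 * int CARD('n) * \<bar>int q * c i - int N * z i\<bar> \<le> int N"
  shows "normal_direction P v0 (\<lambda>i. 8 * int q * c i - 4 * int N * z i) (6 * q * N)"
proof -
  interpret normal_direction P v0 c N by (rule dir)
  have bound: "\<bar>8 * int q * c i - 4 * int N * z i\<bar> \<le> int (6 * q * N)" for i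
  proof -
    have "2 * \<bar>int q * c i - int N * z i\<bar> \<le> 2 * int CARD('n) * \<bar>int q * c i - int N * z i\<bar>"
      by (intro mult_right_mono) (auto simp: Suc_le_eq)
    also have "\<dots> \<le> int N" by (rule z)
    also have "\<dots> \<le> int q * int N" using q by (cases q) (auto simp: algebra_simps)
    finally have 1: "2 * \<bar>int q * c i - int N * z i\<bar> \<le> int q * int N" .
    have 2: "\<bar>int q * c i\<bar> \<le> int q * int N"
      using c_le[of i] by (simp add: abs_mult mult_left_mono)
    have "8 * int q * c i - 4 * int N * z i = 4 * (int q * c i) + 4 * (int q * c i - int N * z i)"
      by (simp add: algebra_simps)
    then have "\<bar>8 * int q * c i - 4 * int N * z i\<bar> \<le> 4 * \<bar>int q * c i\<bar> + 4 * \<bar>int q * c i - int N * z i\<bar>"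
      by linarith
    then show ?thesis using 1 2 by simp
  qed
  show ?thesis
  proof
    show "6 * q * N \<ge> 1" using q N by simp
    fix v assume v: "v \<in> P \<inter> integer_points"
    let ?f = "\<lambda>i. int q * c i - int N * z i"
    have f: "\<bar>lin ?f v - lin ?f v0\<bar> \<le> real N / 2"
    proof -
      have "\<bar>lin ?f v - lin ?f v0\<bar> \<le> (\<Sum>i\<in>UNIV. \<bar>of_int (?f i) * (v $ i - v0 $ i)\<bar>)"
        unfolding lin_diff_points by (rule sum_abs)
      also have "\<dots> \<le> (\<Sum>i\<in>(UNIV::'n set). real N / (2 * real CARD('n)))"
      proof (rule sum_mono)
        fix i
        have "v \<in> cbox 0 1" "v0 \<in> cbox 0 1" using v v0 cube by auto
        then have "0 \<le> v $ i" "v $ i \<le> 1" "0 \<le> v0 $ i" "v0 $ i \<le> 1"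
          by (auto simp: mem_box_cart)
        then have "\<bar>v $ i - v0 $ i\<bar> \<le> 1" by linarith
        moreover have "real_of_int (2 * int CARD('n) * \<bar>?f i\<bar>) \<le> real_of_int (int N)"
          using z[of i] of_int_le_iff by blast
        then have "\<bar>real_of_int (?f i)\<bar> \<le> real N / (2 * real CARD('n))"
          by (simp add: field_simps)
        ultimately have "\<bar>real_of_int (?f i)\<bar> * \<bar>v $ i - v0 $ i\<bar> \<le> real N / (2 * real CARD('n)) * 1"
          by (intro mult_mono) auto
        then show "\<bar>of_int (?f i) * (v $ i - v0 $ i)\<bar> \<le> real N / (2 * real CARD('n))"
          by (simp add: abs_mult)
      qed
      finally show ?thesis by simp
    qed
    obtain a where a: "lin z v - lin z v0 = of_int a"
      using lin_integral[of v z] lin_integral[of v0 z] v v0 by (auto elim!: Ints_cases) (metis of_int_diff)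
    have f_eq: "lin ?f v - lin ?f v0 = real q * (lin c v - lin c v0) - real N * of_int a"
      using a by (simp add: lin_diff lin_scale algebra_simps)
    have qc: "real q * (lin c v - lin c v0) \<le> 0" using opt[OF v] by (simp add: mult_nonneg_nonpos)
    then have "real N * of_int a \<le> real N * (1 / 2)" using f f_eq by linarith
    then have "real_of_int a \<le> 1 / 2" using N by simp
    then have "a \<le> 0" by linarith
    have "2 * (real q * (lin c v - lin c v0)) - real N * of_int a \<le> 0"
    proof (cases "a = 0")
      case False
      with \<open>a \<le> 0\<close> have "real_of_int a \<le> -1" by simp
      then have "real N * of_int a \<le> real N * (-1)" by (intro mult_left_mono) auto
      then show ?thesis using f f_eq by linarith
    qed (use qc in simp)
    then show "lin (\<lambda>i. 8 * int q * c i - 4 * int N * z i) v \<le> lin (\<lambda>i. 8 * int q * c i - 4 * int N * z i) v0"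
      unfolding lin_contracted a[symmetric] by (simp add: algebra_simps)
  qed (use compact cube v0 bound in auto)
qed

text \<open>A bound on the number of closure steps that depends on the dimension only.\<close>

definition stage_bound :: "nat \<Rightarrow> real" where
  "stage_bound n = 12.22 * (real n)\<^sup>2 + 2 * real n + 4"

lemma log2_le:
  assumes "n \<ge> 1"
  shows "log 2 (real n) \<le> 3/5 * real n"
proof -
  have "ln (real n / exp 1) \<le> real n / exp 1 - 1"
    using assms by (intro ln_le_minus_one) auto
  then have "ln (real n) \<le> real n / exp 1" using assms by (simp add: ln_div)
  also have "\<dots> \<le> real n / (5/2)"
  proof -
    have "(5/2 :: real) \<le> exp 1" using exp_lower_Taylor_quadratic[of 1] by simp
    then show ?thesis by (intro divide_left_mono) auto
  qed
  finally have *: "ln (real n) \<le> real n / (5/2)" .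
  have "log 2 (real n) \<le> ln (real n) / (2/3)"
    unfolding log_def using assms ln2_ge_two_thirds by (intro divide_left_mono) auto
  then show ?thesis using * by simp
qed

text \<open>\<open>J\<close> is the number of levels after which the multiples reach the range \<open>(2 n)\<^sup>n\<close> of Dirichlet's
theorem. The count is at most
\<open>3 n log 2 n + 4 (1 + 1 / ln 2) n\<^sup>2 + 2 n + 4\<close>, and crude bounds on the constants suffice.\<close>

lemma stages_le:
  fixes c :: "'n::finite \<Rightarrow> int"
  assumes N: "N \<ge> 1"
  defines "J \<equiv> nat \<lceil>real CARD('n) * log 2 (2 * real CARD('n))\<rceil>"
  shows "(2 * CARD('n)) ^ CARD('n) \<le> 2 ^ J"
    and "real (CARD('n) + (1 + 2 * CARD('n) + (\<Sum>j<J. 1 + 2 * approx_error c N j))) \<le> stage_bound CARD('n)"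
proof -
  define n where "n = CARD('n)"
  have n: "n \<ge> 1" by (simp add: n_def Suc_le_eq)
  define r where "r = real n * log 2 (2 * real n)"
  have r: "r = real n + real n * log 2 (real n)"
    using n by (simp add: r_def log_mult algebra_simps)
  have log0: "0 \<le> log 2 (real n)" using n by simp
  then have r0: "r \<ge> 0" by (simp add: r)
  have J: "real J = of_int \<lceil>r\<rceil>" using r0 by (simp add: J_def r_def n_def)
  have rJ: "r \<le> real J" unfolding J by linarith
  have "real ((2 * n) ^ n) = 2 powr r"
  proof -
    have "2 powr r = (2 powr log 2 (2 * real n)) powr real n"
      by (simp add: r_def powr_powr mult.commute)
    also have "\<dots> = (2 * real n) ^ n" using n by (simp add: powr_realpow)
    finally show ?thesis by simp
  qed
  also have "\<dots> \<le> 2 powr real J" using rJ by simp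
  also have "\<dots> = real (2 ^ J)" by (simp add: powr_realpow)
  finally show "(2 * CARD('n)) ^ CARD('n) \<le> 2 ^ J" unfolding n_def of_nat_le_iff .
  have J_le: "real J \<le> real n + real n * log 2 (real n) + 1" unfolding J using r by linarith
  have "real n * log 2 (real n) \<le> real n * (3/5 * real n)"
    using log2_le[OF n] by (intro mult_left_mono) auto
  then have nlog: "real n * log 2 (real n) \<le> 3/5 * (real n)\<^sup>2" by (simp add: power2_eq_square)
  have "1 / ln 2 \<le> (3/2 :: real)" using ln2_ge_two_thirds by (simp add: field_simps)
  then have "(real n)\<^sup>2 * (1 / ln 2) \<le> (real n)\<^sup>2 * (3/2)" by (intro mult_left_mono) auto
  then have inv: "4 * ((real n)\<^sup>2 * (1 / ln 2)) \<le> 6 * (real n)\<^sup>2" by simp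
  have "real (\<Sum>j<J. approx_error c N j) \<le> real J + 2 * real n * (real n * (1 + 1 / ln 2) - 1)"
    using sum_approx_error_le[OF N, of c J] by (simp add: n_def)
  also have "\<dots> = real J + 2 * (real n)\<^sup>2 + 2 * ((real n)\<^sup>2 * (1 / ln 2)) - 2 * real n"
    by (simp add: power2_eq_square algebra_simps)
  finally have sum: "2 * real (\<Sum>j<J. approx_error c N j) \<le> 2 * real J + 10 * (real n)\<^sup>2 - 4 * real n"
    using inv by linarith
  have "real (n + (1 + 2 * n + (\<Sum>j<J. 1 + 2 * approx_error c N j))) = 3 * real n + 1 + real J + 2 * real (\<Sum>j<J. approx_error c N j)"
    by (simp add: sum.distrib sum_distrib_left)
  also have "\<dots> \<le> 3 * real n + 1 + 3 * real J + 10 * (real n)\<^sup>2 - 4 * real n" using sum by linarith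
  also have "\<dots> \<le> 4 + 2 * real n + (59/5) * (real n)\<^sup>2" using J_le nlog by simp
  also have "\<dots> \<le> 4 + 2 * real n + 12.22 * (real n)\<^sup>2" by (intro add_left_mono mult_right_mono) auto
  also have "\<dots> = 12.22 * (real n)\<^sup>2 + 2 * real n + 4" by simp
  finally show "real (CARD('n) + (1 + 2 * CARD('n) + (\<Sum>j<J. 1 + 2 * approx_error c N j))) \<le> stage_bound CARD('n)"
    by (simp add: n_def stage_bound_def)
qed

text \<open>A number of closure steps, depending on the dimension only, that suffices to reach the integer hull.\<close>

definition last_stage :: "nat \<Rightarrow> nat" where
  "last_stage n = nat \<lfloor>stage_bound n\<rfloor>"

text \<open>Every direction is \<open>1 / (2 q)\<close> times an approximating functional, which is at most its value at
\<open>v0\<close>, plus \<open>3 / 4\<close> of another normal direction; iterating makes the possible violation vanish.\<close>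

lemma normal_direction_contract:
  assumes "normal_direction (P :: (real ^ 'n) set) v0 c N"
    and x: "x \<in> (chvatal_closure ^^ last_stage CARD('n)) P"
  shows "lin c x - lin c v0 \<le> (3/4) ^ k * real CARD('n) * real N"
  using assms(1)
proof (induction k arbitrary: c N)
  case 0
  then interpret normal_direction P v0 c N .
  have "x \<in> cbox 0 1" using iterate_subset_cube[OF compact cube] x by blast
  then show ?case using lin_c_le by simp
next
  case (Suc k)
  interpret normal_direction P v0 c N by (rule Suc.prems)
  define J where "J = nat \<lceil>real CARD('n) * log 2 (2 * real CARD('n))\<rceil>"
  have J: "(2 * CARD('n)) ^ CARD('n) \<le> 2 ^ J"
    unfolding J_def by (rule stages_le(1)[OF N])
  have "CARD('n) + (1 + 2 * CARD('n) + (\<Sum>j<J. 1 + 2 * approx_error c N j)) \<le> last_stage CARD('n)"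
    using stages_le(2)[OF N, of c] unfolding last_stage_def J_def by linarith
  from good_approximation[OF J this x] obtain q z where q: "q \<ge> 1" and zx: "lin z x \<le> lin z v0"
    and z: "\<And>i. 2 * int CARD('n) * \<bar>int q * c i - int N * z i\<bar> \<le> int N" by blast
  note IH = Suc.IH[OF contract_direction[OF Suc.prems q z]]
  have "8 * real q * (lin c x - lin c v0) - 4 * real N * (lin z x - lin z v0)
      \<le> (3/4) ^ k * real CARD('n) * (6 * real q * real N)"
    using IH unfolding lin_contracted by (simp add: algebra_simps)
  moreover have "4 * real N * (lin z x - lin z v0) \<le> 0" using zx by (simp add: mult_nonneg_nonpos)
  ultimately have "8 * real q * (lin c x - lin c v0) \<le> (3/4) ^ k * real CARD('n) * (6 * real q * real N)"
    by linarith
  also have "\<dots> = 8 * real q * ((3/4) ^ Suc k * real CARD('n) * real N)" by simp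
  finally have "real q * (lin c x - lin c v0) \<le> real q * ((3/4) ^ Suc k * real CARD('n) * real N)"
    by (simp add: algebra_simps)
  then show ?case by (rule mult_left_le_imp_le) (use q in simp)
qed

lemma last_stage_optimal:
  assumes dir: "normal_direction (P :: (real ^ 'n) set) v0 c N"
    and x: "x \<in> (chvatal_closure ^^ last_stage CARD('n)) P"
  shows "lin c x \<le> lin c v0"
proof -
  have "(\<lambda>k. (3/4) ^ k * real CARD('n) * real N) \<longlonglongrightarrow> 0 * real CARD('n) * real N"
    by (intro tendsto_intros LIMSEQ_power_zero) auto
  then have "lin c x - lin c v0 \<le> 0 * real CARD('n) * real N"
    by (rule LIMSEQ_le_const) (use normal_direction_contract[OF assms] in auto)
  then show ?thesis by simp
qed

section \<open>Reaching the integer hull\<close>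

lemma finite_cube_integer_points: "finite (cbox 0 1 \<inter> integer_points :: (real ^ 'n) set)"
proof -
  have "cbox 0 1 \<inter> integer_points \<subseteq> {x :: real ^ 'n. \<forall>i. x $ i \<in> {0, 1}}"
  proof (intro subsetI CollectI allI)
    fix x :: "real ^ 'n" and i assume "x \<in> cbox 0 1 \<inter> integer_points"
    then have "0 \<le> x $ i" "x $ i \<le> 1" "x $ i \<in> \<int>" by (auto simp: mem_box_cart integer_points_def)
    then show "x $ i \<in> {0, 1}" by (auto elim!: Ints_cases)
  qed
  moreover have "{x :: real ^ 'n. \<forall>i. x $ i \<in> {0, 1}} \<subseteq> vec_lambda ` (UNIV \<rightarrow>\<^sub>E {0, 1})"
  proof
    fix x :: "real ^ 'n" assume "x \<in> {x. \<forall>i. x $ i \<in> {0, 1}}"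
    then have "vec_nth x \<in> UNIV \<rightarrow>\<^sub>E {0, 1}" by (auto simp: PiE_iff)
    then show "x \<in> vec_lambda ` (UNIV \<rightarrow>\<^sub>E {0, 1})" by (intro image_eqI[of _ _ "vec_nth x"]) simp_all
  qed
  then have "finite {x :: real ^ 'n. \<forall>i. x $ i \<in> {0, 1}}"
    by (rule finite_subset) (intro finite_imageI finite_PiE, auto)
  ultimately show ?thesis by (rule finite_subset)
qed

text \<open>Strict separation from a hull survives rounding a large multiple of the
separating vector to integers, since points of the cube are bounded.\<close>

lemma integer_separation:
  fixes x :: "real ^ 'n"
  assumes V: "V \<subseteq> cbox 0 1" "finite V" and x: "x \<in> cbox 0 1" "x \<notin> convex hull V"
  shows "\<exists>c. \<forall>v\<in>V. lin c v < lin c x"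
proof (cases "V = {}")
  case False
  have "closed (convex hull V)" using V(2) by (intro compact_imp_closed compact_convex_hull finite_imp_compact)
  then obtain a b where ab: "a \<bullet> x < b" "\<And>v. v \<in> convex hull V \<Longrightarrow> b < a \<bullet> v"
    using separating_hyperplane_closed_point[OF convex_convex_hull _ x(2)] by blast
  obtain M :: nat where M: "real CARD('n) < real M * (b - a \<bullet> x)"
    using reals_Archimedean3[of "b - a \<bullet> x"] ab(1) by auto
  \<comment> \<open>The sign turns the lower bound \<open>b\<close> on the hull into an upper bound.\<close>
  define c where "c i = - round (real M * a $ i)" for i
  have close: "\<bar>lin c y + real M * (a \<bullet> y)\<bar> \<le> real CARD('n) / 2" if y: "y \<in> cbox 0 1" for y
  proof -
    have "lin c y + real M * (a \<bullet> y) = (\<Sum>i\<in>UNIV. (of_int (c i) + real M * a $ i) * y $ i)"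
      by (simp add: lin_def inner_vec_def sum_distrib_left sum.distrib algebra_simps)
    also have "\<bar>\<dots>\<bar> \<le> (\<Sum>i\<in>UNIV. \<bar>(of_int (c i) + real M * a $ i) * y $ i\<bar>)" by (rule sum_abs)
    also have "\<dots> \<le> (\<Sum>i\<in>(UNIV::'n set). 1/2)"
    proof (rule sum_mono)
      fix i
      have "\<bar>of_int (c i) + real M * a $ i\<bar> \<le> 1/2"
        using of_int_round_abs_le[of "real M * a $ i"] by (simp add: c_def abs_minus_commute)
      moreover have "\<bar>y $ i\<bar> \<le> 1" using y by (auto simp: mem_box_cart)
      ultimately have "\<bar>of_int (c i) + real M * a $ i\<bar> * \<bar>y $ i\<bar> \<le> 1/2 * 1" by (intro mult_mono) auto
      then show "\<bar>(of_int (c i) + real M * a $ i) * y $ i\<bar> \<le> 1/2" by (simp add: abs_mult)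
    qed
    finally show ?thesis by simp
  qed
  have "lin c v < lin c x" if v: "v \<in> V" for v
  proof -
    have "real M * b \<le> real M * (a \<bullet> v)" using ab(2)[of v] v by (intro mult_left_mono) (auto simp: hull_inc less_imp_le)
    moreover have "\<bar>lin c v + real M * (a \<bullet> v)\<bar> \<le> real CARD('n) / 2" using close V(1) v by blast
    moreover have "real CARD('n) < real M * b - real M * (a \<bullet> x)" using M by (simp add: algebra_simps)
    ultimately show ?thesis using close[OF x(1)] by linarith
  qed
  then show ?thesis by blast
qed auto

lemma iterate_last_stage:
  fixes P :: "(real ^ 'n) set"
  assumes P: "compact P" "P \<subseteq> cbox 0 1"
  shows "(chvatal_closure ^^ last_stage CARD('n)) P = integer_hull P"
proof
  let ?K = "last_stage CARD('n)"
  have K: "CARD('n) + 1 \<le> ?K"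
  proof -
    have "real CARD('n) + 1 \<le> stage_bound CARD('n)" by (simp add: stage_bound_def)
    then show ?thesis unfolding last_stage_def by linarith
  qed
  then obtain K' where "?K = Suc K'" by (cases ?K) auto
  then show "integer_hull P \<subseteq> (chvatal_closure ^^ ?K) P"
    using integer_hull_subset_iterate[OF P] by simp
  let ?V = "P \<inter> integer_points"
  have fin: "finite ?V" using finite_cube_integer_points P(2) by (meson Int_mono finite_subset order_refl)
  show "(chvatal_closure ^^ ?K) P \<subseteq> integer_hull P"
  proof (cases "?V = {}")
    case True
    \<comment> \<open>With no integer points, even \<open>0 \<le> 0\<close> becomes strict.\<close>
    have "holds_from P 0 {x. lin (\<lambda>_. 0) x \<le> of_int 0}"
      by (rule holds_from_mono[OF holds_from_cube]) (auto simp: lin_def)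
    then have "holds_from P (Suc 0) {x. lin (\<lambda>_. 0) x < of_int 0}"
      using True by (intro holds_from_strict[OF P]) auto
    from holds_fromD[OF this P(2,1), of ?K] K show ?thesis by (simp add: lin_def)
  next
    case False
    show ?thesis
    proof (rule ccontr)
      assume "\<not> ?thesis"
      then obtain x where x: "x \<in> (chvatal_closure ^^ ?K) P" "x \<notin> integer_hull P" by blast
      have "x \<in> cbox 0 1" using x(1) iterate_subset_cube[OF P] by blast
      then obtain c where c: "\<And>v. v \<in> ?V \<Longrightarrow> lin c v < lin c x"
        using integer_separation[of ?V x] x(2) fin P(2) unfolding integer_hull_def by blast
      obtain v0 where v0: "v0 \<in> ?V" "\<And>v. v \<in> ?V \<Longrightarrow> lin c v \<le> lin c v0"
        using obtains_MAX[OF fin False] by (metis Max_ge finite_imageI fin imageI)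
      define N where "N = nat (\<Sum>i\<in>UNIV. \<bar>c i\<bar>) + 1"
      have "normal_direction P v0 c N"
      proof
        fix i
        have "\<bar>c i\<bar> \<le> (\<Sum>i\<in>UNIV. \<bar>c i\<bar>)" by (rule member_le_sum) auto
        then show "\<bar>c i\<bar> \<le> int N" by (simp add: N_def)
      qed (use P v0 in \<open>auto simp: N_def\<close>)
      from last_stage_optimal[OF this x(1)] c[OF v0(1)] show False by simp
    qed
  qed
qed

theorem theorem1:
  shows "(\<forall>(P :: (real ^ 'n) set) c :: real ^ 'n.
            compact P \<and> convex P \<and> P \<subseteq> cbox 0 1 \<and> integer_hull P \<noteq> {} \<and>
            c \<in> integer_points \<and> c \<noteq> 0 \<longrightarrow>
            ereal_of_enat (chvatal_depth P c)
              \<le> ereal (12.22 * (real CARD('n))\<^sup>2 + 2 * real CARD('n) + 2 * log 2 (infnorm c) + 4))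
       \<and> (\<forall>P :: (real ^ 'n) set.
            compact P \<and> convex P \<and> P \<subseteq> cbox 0 1 \<longrightarrow>
            ereal_of_enat (chvatal_rank P)
              \<le> ereal (12.22 * (real CARD('n))\<^sup>2 + real CARD('n) * log 2 (real CARD('n))
                         + 2 * real CARD('n) + 4))"
proof (intro conjI allI impI)
  define K where "K = last_stage CARD('n)"
  have K: "real K \<le> 12.22 * (real CARD('n))\<^sup>2 + 2 * real CARD('n) + 4"
    unfolding K_def last_stage_def stage_bound_def by (intro of_nat_floor) simp
  {
    fix P :: "(real ^ 'n) set" and c :: "real ^ 'n"
    assume H: "compact P \<and> convex P \<and> P \<subseteq> cbox 0 1 \<and> integer_hull P \<noteq> {} \<and>
      c \<in> integer_points \<and> c \<noteq> 0"
    then obtain i where i: "c $ i \<noteq> 0" by (auto simp: vec_eq_iff)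
    moreover have "c $ i \<in> \<int>" using H by (auto simp: integer_points_def)
    ultimately have "1 \<le> \<bar>c $ i\<bar>" by (rule Ints_nonzero_abs_ge1[rotated])
    also have "\<dots> \<le> infnorm c" by (rule component_le_infnorm_cart)
    finally have "0 \<le> log 2 (infnorm c)" by simp
    then have bound: "real K \<le> 12.22 * (real CARD('n))\<^sup>2 + 2 * real CARD('n) + 2 * log 2 (infnorm c) + 4"
      using K by simp
    have hull: "(chvatal_closure ^^ K) P = integer_hull P" unfolding K_def using H by (intro iterate_last_stage) auto
    have "bounded (integer_hull P)"
      using iterate_subset_cube[of P K] H bounded_cbox bounded_subset unfolding hull[symmetric] by blast
    then have "bounded ((\<lambda>y. c \<bullet> y) ` integer_hull P)"
      by (intro bounded_linear_image bounded_linear_inner_right)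
    then have "\<forall>x\<in>(chvatal_closure ^^ K) P. c \<bullet> x \<le> (SUP y\<in>integer_hull P. c \<bullet> y)"
      unfolding hull by (auto intro: cSUP_upper bounded_imp_bdd_above)
    with bound show "ereal_of_enat (chvatal_depth P c)
        \<le> ereal (12.22 * (real CARD('n))\<^sup>2 + 2 * real CARD('n) + 2 * log 2 (infnorm c) + 4)"
      unfolding chvatal_depth_le_iff by blast
  next
    fix P :: "(real ^ 'n) set"
    assume "compact P \<and> convex P \<and> P \<subseteq> cbox 0 1"
    then have hull: "(chvatal_closure ^^ K) P = integer_hull P" unfolding K_def by (intro iterate_last_stage) auto
    have "0 \<le> log 2 (real CARD('n))" by (simp add: Suc_le_eq)
    then have "0 \<le> real CARD('n) * log 2 (real CARD('n))" by simp
    then have "real K \<le> 12.22 * (real CARD('n))\<^sup>2 + real CARD('n) * log 2 (real CARD('n))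
        + 2 * real CARD('n) + 4" using K by linarith
    with hull show "ereal_of_enat (chvatal_rank P)
        \<le> ereal (12.22 * (real CARD('n))\<^sup>2 + real CARD('n) * log 2 (real CARD('n))
                   + 2 * real CARD('n) + 4)"
      unfolding chvatal_rank_le_iff by blast
  }
qed

end
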